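(* Let $I$ be a right ideal in $\mathbb{H}[q_1,\ldots,q_n]$. Then $\mathcal{J}(\mathcal{V}(I))=\sqrt{I}$.
   Context: $\mathbb{H}$ is the skew field of quaternions. A slice regular polynomial in $n$ variables is a function $P:\mathbb{H}^n\to\mathbb{H}$ of the form $P(q_1,\ldots,q_n)=\sum_{\ell} q_1^{\ell_1}\cdots q_n^{\ell_n}a_{\ell_1,\ldots,\ell_n}$ (finite sum over multi-indices, variables in this fixed order, coefficients $a_{\ell_1,\ldots,\ell_n}\in\mathbb{H}$ on the right). $\mathbb{H}[q_1,\ldots,q_n]$ is the set of these; it is a (non-commutative) ring under $+$ and the $*$-product, the biadditive extension of $(q_1^{\ell_1}\cdots q_n^{\ell_n}a)*(q_1^{m_1}\cdots q_n^{m_n}b)=q_1^{\ell_1+m_1}\cdots q_n^{\ell_n+m_n}ab$ for $a,b\in\mathbb{H}$. A right ideal is taken with respect to this ring structure (closed under addition, and $I*P\subseteq I$ for every $P\in\mathbb{H}[q_1,\ldots,q_n]$). For a right ideal $I$, $\mathcal{V}(I)\subseteq\mathbb{H}^n$ is the set of common zeros (under pointwise evaluation) of all $P\in I$. For $Z\subseteq\mathbb{H}^n$, $\mathcal{J}(Z)$ is the right ideal generated by the slice regular polynomials vanishing at every point of $Z$, i.e. $\mathcal{J}(Z)=\{\sum_{k=1}^N P_k*Q_k : P_k,Q_k\in\mathbb{H}[q_1,\ldots,q_n],\ P_k|_Z\equiv 0\}$; in particular $\mathcal{J}(\varnothing)=\mathbb{H}[q_1,\ldots,q_n]$. A right ideal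 $L$ is completely prime if for any $P,Q\in\mathbb{H}[q_1,\ldots,q_n]$ such that $P*Q\in L$ and $P*L\subseteq L$ we have $P\in L$ or $Q\in L$. The right radical $\sqrt{I}$ of a right ideal $I$ is the intersection of all completely prime right ideals containing $I$. *)

theory Defs
  imports "HOL-Analysis.Analysis" "HOL-Library.Poly_Mapping"
begin

section \<open>Quaternions\<close>

datatype quat = Quat (q_re: real) (q_i: real) (q_j: real) (q_k: real)

instantiation quat :: real_algebra_1
begin

definition zero_quat :: quat where "0 = Quat 0 0 0 0"

definition one_quat :: quat where "1 = Quat 1 0 0 0"

definition uminus_quat :: "quat \<Rightarrow> quat" where
  "- x = Quat (- q_re x) (- q_i x) (- q_j x) (- q_k x)"

definition plus_quat :: "quat \<Rightarrow> quat \<Rightarrow> quat" where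
  "x + y = Quat (q_re x + q_re y) (q_i x + q_i y) (q_j x + q_j y) (q_k x + q_k y)"

definition minus_quat :: "quat \<Rightarrow> quat \<Rightarrow> quat" where
  "x - y = Quat (q_re x - q_re y) (q_i x - q_i y) (q_j x - q_j y) (q_k x - q_k y)"

definition times_quat :: "quat \<Rightarrow> quat \<Rightarrow> quat" where
  "x * y = Quat
     (q_re x * q_re y - q_i x * q_i y - q_j x * q_j y - q_k x * q_k y)
     (q_re x * q_i y + q_i x * q_re y + q_j x * q_k y - q_k x * q_j y)
     (q_re x * q_j y - q_i x * q_k y + q_j x * q_re y + q_k x * q_i y)
     (q_re x * q_k y + q_i x * q_j y - q_j x * q_i y + q_k x * q_re y)"

definition scaleR_quat :: "real \<Rightarrow> quat \<Rightarrow> quat" where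
  "r *\<^sub>R x = Quat (r * q_re x) (r * q_i x) (r * q_j x) (r * q_k x)"

lemmas quat_defs = zero_quat_def one_quat_def uminus_quat_def plus_quat_def
  minus_quat_def times_quat_def scaleR_quat_def

instance
  by standard (simp_all add: quat_defs quat.expand, (simp add: algebra_simps)+)

end

instantiation quat :: real_div_algebra
begin

definition inverse_quat :: "quat \<Rightarrow> quat" where
  "inverse x = (1 / ((q_re x)\<^sup>2 + (q_i x)\<^sup>2 + (q_j x)\<^sup>2 + (q_k x)\<^sup>2)) *\<^sub>R
     Quat (q_re x) (- q_i x) (- q_j x) (- q_k x)"

definition divide_quat :: "quat \<Rightarrow> quat \<Rightarrow> quat" where
  "x div y = x * inverse y" for x y :: quat

instance
proof
  fix x y :: quat
  show "x div y = x * inverse y"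
    by (rule divide_quat_def)
  show "inverse (0 :: quat) = 0"
    by (simp add: inverse_quat_def quat_defs)
  let ?N = "(q_re x)\<^sup>2 + (q_i x)\<^sup>2 + (q_j x)\<^sup>2 + (q_k x)\<^sup>2"
  let ?c = "Quat (q_re x) (- q_i x) (- q_j x) (- q_k x)"
  assume "x \<noteq> 0"
  then have N: "?N \<noteq> 0"
    by (cases x) (auto simp: zero_quat_def add_nonneg_eq_0_iff)
  have "?c * x = ?N *\<^sub>R 1" "x * ?c = ?N *\<^sub>R 1"
    by (simp_all add: quat_defs power2_eq_square algebra_simps)
  with N show "inverse x * x = 1" "x * inverse x = 1"
    by (simp_all add: inverse_quat_def)
qed

end

section \<open>Slice regular polynomials\<close>

text \<open>
  The variables are indexed by a finite linear order \<open>'n\<close>, so \<open>n = CARD('n)\<close>; the order on \<open>'n\<close>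
  is the order in which the variables are multiplied under evaluation.
  A polynomial is represented by its finite family of coefficients. The type
  \<open>('n \<Rightarrow>\<^sub>0 nat) \<Rightarrow>\<^sub>0 quat\<close> carries the ring structure of a monoid ring, whose multiplication is the
  \<open>*\<close>-product (see \<open>mult_single\<close>); a polynomial function determines its
  coefficients (\<open>qpoly_eval_inject\<close> below), so that these are the polynomial functions.
\<close>

type_synonym 'n qpoly = "('n \<Rightarrow>\<^sub>0 nat) \<Rightarrow>\<^sub>0 quat"

definition monom_eval :: "('n::{finite,linorder} \<Rightarrow>\<^sub>0 nat) \<Rightarrow> quat ^ 'n::{finite,linorder} \<Rightarrow> quat" where
  "monom_eval l q = prod_list (map (\<lambda>i. (q $ i) ^ Poly_Mapping.lookup l i) (sorted_list_of_set UNIV))"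

definition qpoly_eval :: "'n::{finite,linorder} qpoly \<Rightarrow> quat ^ 'n::{finite,linorder} \<Rightarrow> quat" where
  "qpoly_eval P q = (\<Sum>l\<in>Poly_Mapping.keys P. monom_eval l q * Poly_Mapping.lookup P l)"

lemma independent_monoms:
  fixes c :: "('n::finite \<Rightarrow>\<^sub>0 nat) \<Rightarrow> 'v::real_vector"
  assumes "finite S"
    and "\<And>t :: 'n \<Rightarrow> real. (\<Sum>l\<in>S. (\<Prod>i\<in>UNIV. t i ^ Poly_Mapping.lookup l i) *\<^sub>R c l) = 0"
    and "l \<in> S"
  shows "c l = 0"
  using assms
proof (induction S arbitrary: c l rule: finite_induct)
  case empty
  then show ?case by simp
next
  case (insert a S)
  define X where "X l t = (\<Prod>i\<in>UNIV. t i ^ Poly_Mapping.lookup l i)" for l :: "'n \<Rightarrow>\<^sub>0 nat" and t :: "'n \<Rightarrow> real"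
  have X_mult: "X l (\<lambda>i. s i * t i) = X l s * X l t" for l s t
    by (simp add: X_def power_mult_distrib prod.distrib)
  have sum0: "X a t *\<^sub>R c a + (\<Sum>l\<in>S. X l t *\<^sub>R c l) = 0" for t
    using insert.prems(1)[of t] insert.hyps by (simp add: X_def)
  have cS: "c l = 0" if "l \<in> S" for l
  proof -
    have ind: "(X l s - X a s) *\<^sub>R c l = 0" for s
    proof (rule insert.IH[OF _ that, of "\<lambda>l. (X l s - X a s) *\<^sub>R c l"])
      fix t
      have "(\<Sum>l\<in>S. X l t *\<^sub>R (X l s - X a s) *\<^sub>R c l)
          = (X a (\<lambda>i. s i * t i) *\<^sub>R c a + (\<Sum>l\<in>S. X l (\<lambda>i. s i * t i) *\<^sub>R c l))
            - X a s *\<^sub>R (X a t *\<^sub>R c a + (\<Sum>l\<in>S. X l t *\<^sub>R c l))"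
        by (simp add: X_mult scaleR_right_distrib scaleR_sum_right sum_subtractf algebra_simps)
      also have "\<dots> = 0"
        by (simp only: sum0) simp
      finally show "(\<Sum>l\<in>S. (\<Prod>i\<in>UNIV. t i ^ Poly_Mapping.lookup l i) *\<^sub>R (X l s - X a s) *\<^sub>R c l) = 0"
        by (simp add: X_def)
    qed
    from that insert.hyps have "l \<noteq> a" by auto
    then obtain i where i: "Poly_Mapping.lookup l i \<noteq> Poly_Mapping.lookup a i"
      by (meson poly_mapping_eqI)
    have "X m (\<lambda>j. if j = i then 2 else 1) = 2 ^ Poly_Mapping.lookup m i" for m
    proof -
      have "X m (\<lambda>j. if j = i then 2 else 1) = (\<Prod>j\<in>UNIV. if j = i then 2 ^ Poly_Mapping.lookup m j else 1)"
        unfolding X_def by (rule prod.cong) auto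
      then show ?thesis by simp
    qed
    with i ind[of "\<lambda>j. if j = i then 2 else 1"] show ?thesis by simp
  qed
  moreover have "c a = 0"
    using sum0[of "\<lambda>_. 1"] cS by (simp add: X_def)
  ultimately show ?case
    using insert.prems by auto
qed

lemma prod_list_of_real:
  "prod_list (map of_real xs) = (of_real (prod_list xs) :: 'a::real_algebra_1)"
  by (induction xs) simp_all

lemma monom_eval_of_real:
  "monom_eval l (\<chi> i. of_real (t i)) = of_real (\<Prod>i\<in>UNIV. t i ^ Poly_Mapping.lookup l i)"
proof -
  have "monom_eval l (\<chi> i. of_real (t i))
      = prod_list (map of_real (map (\<lambda>i. t i ^ Poly_Mapping.lookup l i) (sorted_list_of_set UNIV)))"
    by (simp add: monom_eval_def comp_def)
  also have "\<dots> = of_real (prod_list (map (\<lambda>i. t i ^ Poly_Mapping.lookup l i) (sorted_list_of_set UNIV)))"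
    by (rule prod_list_of_real)
  also have "prod_list (map (\<lambda>i. t i ^ Poly_Mapping.lookup l i) (sorted_list_of_set UNIV))
      = (\<Prod>i\<in>UNIV. t i ^ Poly_Mapping.lookup l i)"
    by (subst prod.distinct_set_conv_list[symmetric]) auto
  finally show ?thesis .
qed

lemma qpoly_eval_superset:
  "finite S \<Longrightarrow> Poly_Mapping.keys P \<subseteq> S \<Longrightarrow> qpoly_eval P q = (\<Sum>l\<in>S. monom_eval l q * Poly_Mapping.lookup P l)"
  unfolding qpoly_eval_def by (rule sum.mono_neutral_left) (auto simp: in_keys_iff)

lemma qpoly_eval_inject: "qpoly_eval P = qpoly_eval Q \<longleftrightarrow> P = Q"
proof
  assume eq: "qpoly_eval P = qpoly_eval Q"
  let ?S = "Poly_Mapping.keys P \<union> Poly_Mapping.keys Q"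
  have "Poly_Mapping.lookup P l - Poly_Mapping.lookup Q l = 0" if "l \<in> ?S" for l
  proof (rule independent_monoms[OF _ _ that])
    fix t :: "'a \<Rightarrow> real"
    define q :: "quat ^ 'a::{finite,linorder}" where "q = (\<chi> i. of_real (t i))"
    have "(\<Sum>l\<in>?S. (\<Prod>i\<in>UNIV. t i ^ Poly_Mapping.lookup l i) *\<^sub>R (Poly_Mapping.lookup P l - Poly_Mapping.lookup Q l))
        = (\<Sum>l\<in>?S. monom_eval l q * Poly_Mapping.lookup P l) - (\<Sum>l\<in>?S. monom_eval l q * Poly_Mapping.lookup Q l)"
      by (simp add: q_def monom_eval_of_real scaleR_conv_of_real right_diff_distrib sum_subtractf)
    also have "\<dots> = qpoly_eval P q - qpoly_eval Q q"
      by (simp add: qpoly_eval_superset[where S = ?S])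
    finally show "(\<Sum>l\<in>?S. (\<Prod>i\<in>UNIV. t i ^ Poly_Mapping.lookup l i) *\<^sub>R (Poly_Mapping.lookup P l - Poly_Mapping.lookup Q l)) = 0"
      by (simp add: eq)
  qed simp
  then have "Poly_Mapping.lookup P l = Poly_Mapping.lookup Q l" for l
    by (cases "l \<in> ?S") (auto simp: in_keys_iff)
  then show "P = Q" by (rule poly_mapping_eqI)
qed simp

section \<open>Right ideals, zero sets and the right radical\<close>

definition right_ideal :: "'a::ring_1 set \<Rightarrow> bool" where
  "right_ideal I \<longleftrightarrow>
     0 \<in> I \<and> (\<forall>P\<in>I. \<forall>Q\<in>I. P + Q \<in> I) \<and> (\<forall>P\<in>I. \<forall>Q. P * Q \<in> I)"

definition zero_set :: "'n::{finite,linorder} qpoly set \<Rightarrow> (quat ^ 'n::{finite,linorder}) set" where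
  "zero_set I = {q. \<forall>P\<in>I. qpoly_eval P q = 0}"

definition vanishing_ideal :: "(quat ^ 'n::{finite,linorder}) set \<Rightarrow> 'n::{finite,linorder} qpoly set" where
  "vanishing_ideal Z =
     {\<Sum>k<N. P k * Q k | (N::nat) P Q. \<forall>k<N. \<forall>q\<in>Z. qpoly_eval (P k) q = 0}"

text \<open>
  The whole ring satisfies this definition as well; including or excluding it
  does not affect the intersection defining the radical.
\<close>

definition completely_prime :: "'a::ring_1 set \<Rightarrow> bool" where
  "completely_prime L \<longleftrightarrow> right_ideal L \<and>
     (\<forall>P Q. P * Q \<in> L \<and> (\<forall>R\<in>L. P * R \<in> L) \<longrightarrow> P \<in> L \<or> Q \<in> L)"

definition right_radical :: "'a::ring_1 set \<Rightarrow> 'a set" where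
  "right_radical I = \<Inter> {L. completely_prime L \<and> I \<subseteq> L}"

end

theory Submission
  imports Defs "HOL-Computational_Algebra.Fundamental_Theorem_Algebra"
begin

text \<open>
  If \<open>q\<close> has commuting coordinates, the polynomials vanishing at \<open>q\<close> form a completely prime right
  ideal. Conversely, a completely prime \<open>L\<close> is the intersection of such ideals: for \<open>f \<notin> L\<close> the
  quaternionic conjugation yields a central \<open>z \<notin> L\<close> with \<open>f * Q - z \<in> L\<close>, and modulo a right
  ideal \<open>M \<supseteq> L\<close> that is maximal with respect to avoiding the powers of \<open>z\<close> every variable satisfies
  a real quadratic equation, because \<open>\<real>\<close> is uncountable while the polynomials have countable
  dimension. Right ideals containing such equations are, by semisimplicity of the quotient,
  intersections of ideals of commuting points.

  For an arbitrary zero \<open>q\<close> of \<open>I\<close>, the largest right ideal of polynomials vanishing at \<open>q\<close> also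
  contains a real quadratic (or linear) equation for each variable. Hence it is such an intersection
  as well, and a polynomial vanishing at the commuting zeros of \<open>I\<close> vanishes at all zeros of \<open>I\<close>.
\<close>

section \<open>Right ideals and central elements\<close>

lemma right_idealD:
  assumes "right_ideal I"
  shows right_ideal_zero: "0 \<in> I"
    and right_ideal_add: "P \<in> I \<Longrightarrow> Q \<in> I \<Longrightarrow> P + Q \<in> I"
    and right_ideal_mult: "P \<in> I \<Longrightarrow> P * R \<in> I"
  using assms unfolding right_ideal_def by auto

lemma right_ideal_uminus: "right_ideal I \<Longrightarrow> P \<in> I \<Longrightarrow> - P \<in> I"
  using right_ideal_mult[of I P "-1"] by simp

lemma right_ideal_diff: "right_ideal I \<Longrightarrow> P \<in> I \<Longrightarrow> Q \<in> I \<Longrightarrow> P - Q \<in> I"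
  using right_ideal_add[of I P "- Q"] right_ideal_uminus[of I Q] by simp

lemma right_ideal_sum:
  "right_ideal I \<Longrightarrow> (\<And>k. k \<in> A \<Longrightarrow> f k \<in> I) \<Longrightarrow> sum f A \<in> I"
  by (induction A rule: infinite_finite_induct) (auto intro: right_idealD)

lemma right_ideal_cong:
  assumes "right_ideal I" "P - Q \<in> I"
  shows "P \<in> I \<longleftrightarrow> Q \<in> I"
proof
  assume "P \<in> I"
  then show "Q \<in> I" using right_ideal_diff[OF assms(1), of P "P - Q"] assms(2) by simp
next
  assume "Q \<in> I"
  then show "P \<in> I" using right_ideal_add[OF assms(1), of "P - Q" Q] assms(2) by simp
qed

lemma right_ideal_sum_ideal:
  assumes "right_ideal M"
  shows "right_ideal {m + g * Q | m Q. m \<in> M}" (is "right_ideal ?N")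
  unfolding right_ideal_def
proof (intro conjI ballI allI)
  have "0 = 0 + g * 0" by simp
  then show "0 \<in> ?N" using right_ideal_zero[OF assms] by blast
next
  fix P Q assume "P \<in> ?N" "Q \<in> ?N"
  then obtain m1 Q1 m2 Q2 where "P = m1 + g * Q1" "Q = m2 + g * Q2" "m1 \<in> M" "m2 \<in> M"
    by blast
  then have "P + Q = (m1 + m2) + g * (Q1 + Q2)" "m1 + m2 \<in> M"
    using right_ideal_add[OF assms] by (auto simp: algebra_simps)
  then show "P + Q \<in> ?N" by blast
next
  fix P R assume "P \<in> ?N"
  then obtain m1 Q1 where "P = m1 + g * Q1" "m1 \<in> M"
    by blast
  then have "P * R = m1 * R + g * (Q1 * R)" "m1 * R \<in> M"
    using right_ideal_mult[OF assms] by (auto simp: algebra_simps)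
  then show "P * R \<in> ?N" by blast
qed

text \<open>Zorn's lemma. The last conclusion holds because adjoining all \<open>g * Q\<close> to
  \<open>M\<close> gives a strictly larger right ideal, which must meet \<open>S\<close>. It serves
  below for \<open>S = {f}\<close> and for the powers of a central element.\<close>

lemma maximal_right_ideal_avoiding:
  assumes "right_ideal K" "K \<inter> S = {}"
  obtains M where "right_ideal M" "K \<subseteq> M" "M \<inter> S = {}"
    "\<And>N. right_ideal N \<Longrightarrow> M \<subseteq> N \<Longrightarrow> N \<inter> S = {} \<Longrightarrow> N = M"
    "\<And>g. g \<notin> M \<Longrightarrow> \<exists>Q. \<exists>s\<in>S. s - g * Q \<in> M"
proof -
  define F where "F = {N. right_ideal N \<and> K \<subseteq> N \<and> N \<inter> S = {}}"
  have "\<exists>M\<in>F. \<forall>X\<in>F. M \<subseteq> X \<longrightarrow> X = M"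
  proof (rule subset_Zorn_nonempty)
    show "F \<noteq> {}" using assms by (auto simp: F_def)
    fix C assume "C \<noteq> {}" and chain: "subset.chain F C"
    then have F: "\<And>N. N \<in> C \<Longrightarrow> N \<in> F" and lin: "\<And>N N'. N \<in> C \<Longrightarrow> N' \<in> C \<Longrightarrow> N \<subseteq> N' \<or> N' \<subseteq> N"
      by (auto simp: subset.chain_def)
    have "right_ideal (\<Union>C)"
      unfolding right_ideal_def
    proof (intro conjI ballI allI)
      show "0 \<in> \<Union>C" using \<open>C \<noteq> {}\<close> F unfolding F_def by (auto intro: right_ideal_zero)
    next
      fix P Q assume "P \<in> \<Union>C" "Q \<in> \<Union>C"
      then obtain N where "N \<in> C" "P \<in> N" "Q \<in> N" using lin by blast
      then show "P + Q \<in> \<Union>C" using F unfolding F_def by (auto intro: right_ideal_add)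
    next
      fix P R assume "P \<in> \<Union>C"
      then show "P * R \<in> \<Union>C" using F unfolding F_def by (auto intro: right_ideal_mult)
    qed
    then show "\<Union>C \<in> F" using \<open>C \<noteq> {}\<close> F unfolding F_def by blast
  qed
  then obtain M where "M \<in> F" and Max: "\<And>X. X \<in> F \<Longrightarrow> M \<subseteq> X \<Longrightarrow> X = M"
    by blast
  then have M: "right_ideal M" "K \<subseteq> M" "M \<inter> S = {}"
    by (auto simp: F_def)
  have max: "N = M" if "right_ideal N" "M \<subseteq> N" "N \<inter> S = {}" for N
    using that M(2) by (intro Max) (auto simp: F_def)
  have "\<exists>Q. \<exists>s\<in>S. s - g * Q \<in> M" if "g \<notin> M" for g
  proof (rule ccontr)
    assume neg: "\<not> ?thesis"
    let ?N = "{m + g * Q | m Q. m \<in> M}"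
    have "M \<subseteq> ?N"
    proof
      fix m assume "m \<in> M"
      moreover have "m = m + g * 0" by simp
      ultimately show "m \<in> ?N" by blast
    qed
    moreover have "?N \<inter> S = {}"
    proof -
      have False if "m \<in> M" "m + g * Q \<in> S" for m Q
      proof -
        have "m + g * Q - g * Q \<in> M" using that(1) by simp
        with neg that(2) show False by blast
      qed
      then show ?thesis by auto
    qed
    ultimately have "?N = M"
      using max right_ideal_sum_ideal[OF M(1)] by blast
    moreover have "g = 0 + g * 1" by simp
    then have "g \<in> ?N" using right_ideal_zero[OF M(1)] by blast
    ultimately show False using that by simp
  qed
  with M max show ?thesis using that[of M] by simp
qed

section \<open>Central elements\<close>

definition central :: "'a::ring_1 \<Rightarrow> bool" where
  "central c \<longleftrightarrow> (\<forall>P. c * P = P * c)"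

lemma central_commute: "central c \<Longrightarrow> c * P = P * c"
  unfolding central_def by blast

lemma central_add: "central c \<Longrightarrow> central d \<Longrightarrow> central (c + d)"
  unfolding central_def by (simp add: algebra_simps)

lemma central_diff: "central c \<Longrightarrow> central d \<Longrightarrow> central (c - d)"
  unfolding central_def by (simp add: algebra_simps)

lemma central_mult: "central c \<Longrightarrow> central d \<Longrightarrow> central (c * d)"
  unfolding central_def by (metis mult.assoc)

lemma central_one: "central 1"
  unfolding central_def by simp

lemma central_zero: "central 0"
  unfolding central_def by simp

lemma central_power: "central c \<Longrightarrow> central (c ^ k)"
  by (induction k) (auto intro: central_mult central_one)

lemma central_sum: "(\<And>k. k \<in> A \<Longrightarrow> central (f k)) \<Longrightarrow> central (sum f A)"
  by (induction A rule: infinite_finite_induct) (auto intro: central_add central_zero)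

text \<open>A right ideal need not be stable under multiplication from the left; central factors are
  always safe.\<close>

lemma right_ideal_central_mult:
  "right_ideal I \<Longrightarrow> central c \<Longrightarrow> P \<in> I \<Longrightarrow> c * P \<in> I"
  by (simp add: central_commute right_ideal_mult)

text \<open>This colon ideal contains \<open>M\<close>. Confronted with maximality of
  \<open>M\<close>, it makes \<open>c\<close> cancellable modulo \<open>M\<close>.\<close>

lemma right_ideal_colon:
  assumes "right_ideal M" "central c"
  shows "right_ideal {P. c * P \<in> M}"
  unfolding right_ideal_def
  using right_idealD[OF assms(1)] by (auto simp: distrib_left mult.assoc[symmetric])

section \<open>Constants, variables and monomials\<close>

definition qconst :: "quat \<Rightarrow> 'n qpoly" where
  "qconst a = Poly_Mapping.single 0 a"

abbreviation qreal :: "real \<Rightarrow> 'n qpoly" where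
  "qreal r \<equiv> qconst (of_real r)"

definition qvar :: "'n \<Rightarrow> 'n qpoly" where
  "qvar i = Poly_Mapping.single (Poly_Mapping.single i 1) 1"

lemma qconst_0 [simp]: "qconst 0 = 0"
  and qconst_1 [simp]: "qconst 1 = 1"
  and qconst_add: "qconst (a + b) = qconst a + qconst b"
  and qconst_minus: "qconst (- a) = - qconst a"
  and qconst_diff: "qconst (a - b) = qconst a - qconst b"
  and qconst_mult: "qconst (a * b) = qconst a * qconst b"
  by (simp_all add: qconst_def single_add single_uminus single_diff mult_single)

lemma qconst_numeral: "qconst (numeral n) = numeral n"
  by (simp add: qconst_def)

lemma qconst_mult_single: "qconst a * Poly_Mapping.single l b = Poly_Mapping.single l (a * b)"
  and qvar_mult_single:
    "qvar i * Poly_Mapping.single l b = Poly_Mapping.single (Poly_Mapping.single i 1 + l) b"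
  by (simp_all add: qconst_def qvar_def mult_single)

lemma qpoly_induct [case_names single add]:
  fixes P :: "'n qpoly"
  assumes single: "\<And>l a. A (Poly_Mapping.single l a)"
    and add: "\<And>P Q. A P \<Longrightarrow> A Q \<Longrightarrow> A (P + Q)"
  shows "A P"
proof (induction P rule: update_induct)
  case const
  show ?case using single[of 0 0] by simp
next
  case (update f a b)
  have "Poly_Mapping.update a b f = f + Poly_Mapping.single a b"
    using update(1)
    by (intro poly_mapping_eqI)
       (auto simp: lookup_update lookup_add lookup_single when_def in_keys_iff)
  with update single add show ?case by simp
qed

text \<open>Induction on the total degree; each step corresponds to a left multiplication by
  \<open>qvar i\<close>.\<close>

lemma monom_induct [case_names zero add]:
  fixes l :: "'n::finite \<Rightarrow>\<^sub>0 nat"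
  assumes zero: "A 0"
    and add: "\<And>i l. A l \<Longrightarrow> A (Poly_Mapping.single i 1 + l)"
  shows "A l"
proof (induction "\<Sum>i\<in>UNIV. Poly_Mapping.lookup l i" arbitrary: l)
  case 0
  then have "l = 0" by (intro poly_mapping_eqI) simp
  with zero show ?case by simp
next
  case (Suc s)
  then have "\<exists>i. Poly_Mapping.lookup l i \<noteq> 0" by (metis nat.distinct(1) sum.neutral)
  then obtain i where i: "Poly_Mapping.lookup l i \<noteq> 0" ..
  define m where "m = l - Poly_Mapping.single i 1"
  have l: "l = Poly_Mapping.single i 1 + m"
    using i by (intro poly_mapping_eqI) (auto simp: m_def lookup_add lookup_minus lookup_single when_def)
  have "(\<Sum>j\<in>UNIV. Poly_Mapping.lookup l j) = Suc (\<Sum>j\<in>UNIV. Poly_Mapping.lookup m j)"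
    by (simp add: l lookup_add sum.distrib lookup_single when_def)
  with Suc have "A m" by simp
  then show ?case using add l by simp
qed

lemma central_qpolyI:
  fixes c :: "'n qpoly"
  assumes "\<And>l a. c * Poly_Mapping.single l a = Poly_Mapping.single l a * c"
  shows "central c"
  unfolding central_def
proof
  fix P show "c * P = P * c"
    by (induction P rule: qpoly_induct) (use assms in \<open>simp_all add: algebra_simps\<close>)
qed

lemma central_single_of_real: "central (Poly_Mapping.single l (of_real r) :: 'n qpoly)"
  by (rule central_qpolyI) (simp add: mult_single add.commute of_real_def)

lemma central_qreal: "central (qreal r)"
  unfolding qconst_def by (rule central_single_of_real)

lemma central_qvar: "central (qvar i)"
  unfolding qvar_def using central_single_of_real[of _ 1] by simp

section \<open>Conjugation\<close>

definition qi :: quat where "qi = Quat 0 1 0 0"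
definition qj :: quat where "qj = Quat 0 0 1 0"
definition qk :: quat where "qk = Quat 0 0 0 1"

definition quat_cnj :: "quat \<Rightarrow> quat" where
  "quat_cnj x = Quat (q_re x) (- q_i x) (- q_j x) (- q_k x)"

lemmas quat_basis_defs = qi_def qj_def qk_def quat_cnj_def

lemma quat_cnj_0 [simp]: "quat_cnj 0 = 0"
  and quat_cnj_add: "quat_cnj (x + y) = quat_cnj x + quat_cnj y"
  and quat_cnj_mult: "quat_cnj (x * y) = quat_cnj y * quat_cnj x"
  and quat_cnj_cnj: "quat_cnj (quat_cnj x) = x"
  by (simp_all add: quat_basis_defs quat_defs algebra_simps)

lemma of_real_quat: "of_real r = Quat r 0 0 0"
  by (simp add: of_real_def quat_defs)

lemma quat_cnj_fixed: "quat_cnj x = x \<Longrightarrow> x = of_real (q_re x)"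
  by (cases x) (simp add: quat_basis_defs of_real_quat)

text \<open>Conjugation becomes a sum of two-sided multiplications. A right ideal containing the
  left multiples of an element by 1, \<open>qi\<close>, \<open>qj\<close> and \<open>qk\<close>
  therefore contains twice its conjugate.\<close>

lemma quat_cnj_conv: "2 * quat_cnj x = - (x + qi * x * qi + qj * x * qj + qk * x * qk)"
proof -
  have "2 * quat_cnj x = quat_cnj x + quat_cnj x" by (rule mult_2)
  then show ?thesis by (simp add: quat_basis_defs quat_defs)
qed

text \<open>The traces of \<open>x\<close>, \<open>x * qi\<close>, \<open>x * qj\<close>,
  \<open>x * qk\<close> are, up to the factors 2 and -2, the four real coordinates of
  \<open>x\<close>.\<close>

lemma quat_conv_traces:
  defines "t \<equiv> \<lambda>x. x + quat_cnj x"
  shows "2 * x = t x - t (x * qi) * qi - t (x * qj) * qj - t (x * qk) * qk"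
proof -
  have "2 * x = x + x" by (rule mult_2)
  then show ?thesis by (simp add: t_def quat_basis_defs quat_defs)
qed

definition qcnj :: "'n qpoly \<Rightarrow> 'n qpoly" where
  "qcnj P = Poly_Mapping.map quat_cnj P"

lemma lookup_qcnj: "Poly_Mapping.lookup (qcnj P) l = quat_cnj (Poly_Mapping.lookup P l)"
  by (simp add: qcnj_def map.rep_eq when_def)

lemma qcnj_single [simp]: "qcnj (Poly_Mapping.single l a) = Poly_Mapping.single l (quat_cnj a)"
  by (simp add: qcnj_def)

lemma qcnj_add: "qcnj (P + Q) = qcnj P + qcnj Q"
  by (intro poly_mapping_eqI) (simp add: lookup_qcnj lookup_add quat_cnj_add)

lemma qcnj_cnj [simp]: "qcnj (qcnj P) = P"
  by (intro poly_mapping_eqI) (simp add: lookup_qcnj quat_cnj_cnj)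

text \<open>Monomials with coefficient 1 are central, so the reversal of products is inherited from
  the coefficients.\<close>

lemma qcnj_mult: "qcnj (P * Q) = qcnj Q * qcnj P"
proof (induction P rule: qpoly_induct)
  case (single l a)
  show ?case
    by (induction Q rule: qpoly_induct)
       (simp_all add: mult_single quat_cnj_mult add.commute qcnj_add algebra_simps)
qed (simp add: qcnj_add algebra_simps)

text \<open>A fixed polynomial has real coefficients, and monomials with real coefficients are
  central.\<close>

lemma central_if_qcnj_fixed:
  assumes "qcnj P = P"
  shows "central P"
proof -
  have "Poly_Mapping.lookup P l = of_real (q_re (Poly_Mapping.lookup P l))" for l
    using assms lookup_qcnj[of P l] quat_cnj_fixed by metis
  then have "central (Poly_Mapping.single l (Poly_Mapping.lookup P l))" for l
    by (metis central_single_of_real)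
  then have "central (\<Sum>l\<in>Poly_Mapping.keys P. Poly_Mapping.single l (Poly_Mapping.lookup P l))"
    by (intro central_sum)
  also have "(\<Sum>l\<in>Poly_Mapping.keys P. Poly_Mapping.single l (Poly_Mapping.lookup P l)) = P"
    by (intro poly_mapping_eqI)
       (auto simp: lookup_sum lookup_single when_def in_keys_iff if_distrib sum.delta cong: if_cong)
  finally show ?thesis .
qed

lemma central_trace: "central (P + qcnj P)"
  by (rule central_if_qcnj_fixed) (simp add: qcnj_add add.commute)

lemma central_norm: "central (P * qcnj P)"
  by (rule central_if_qcnj_fixed) (simp add: qcnj_mult)

text \<open>The central trace \<open>P + qcnj P\<close> commutes with \<open>P\<close>; cancel
  \<open>P * P\<close>.\<close>

lemma qcnj_mult_self: "qcnj P * P = P * qcnj P"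
proof -
  have "qcnj P * P + P * P = P * qcnj P + P * P"
    using central_commute[OF central_trace, of P P] by (simp add: algebra_simps)
  then show ?thesis by simp
qed

lemma qcnj_conv:
  "2 * qcnj P = - (P + qconst qi * P * qconst qi + qconst qj * P * qconst qj + qconst qk * P * qconst qk)"
proof (induction P rule: qpoly_induct)
  case (single l a)
  have "2 * qcnj (Poly_Mapping.single l a) = Poly_Mapping.single l (2 * quat_cnj a)"
    using qconst_mult_single[of 2 l "quat_cnj a"] by (simp add: qconst_def)
  then show ?case
    by (simp add: quat_cnj_conv qconst_def mult_single single_add[symmetric] single_uminus[symmetric])
next
  case (add P Q)
  have "2 * qcnj (P + Q) = 2 * qcnj P + 2 * qcnj Q"
    by (simp only: qcnj_add distrib_left)
  then show ?case
    unfolding add by (simp add: distrib_left distrib_right)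
qed

text \<open>Consequence used below: if the traces of all right multiples of \<open>P\<close> lie in
  a right ideal, so does \<open>2 * P\<close>.\<close>

lemma qpoly_conv_traces:
  fixes P :: "'n qpoly"
  defines "t \<equiv> \<lambda>P :: 'n qpoly. P + qcnj P"
  shows "2 * P = t P - t (P * qconst qi) * qconst qi - t (P * qconst qj) * qconst qj
    - t (P * qconst qk) * qconst qk"
proof (induction P rule: qpoly_induct)
  case (single l a)
  have "2 * Poly_Mapping.single l a = Poly_Mapping.single l (2 * a)"
    using qconst_mult_single[of 2 l a] by (simp add: qconst_def)
  then show ?case
    unfolding quat_conv_traces[of a]
    by (simp add: t_def qconst_def mult_single single_add[symmetric] single_diff[symmetric])
next
  case (add P Q)
  have "2 * (P + Q) = 2 * P + 2 * Q"
    by (simp only: distrib_left)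
  also have "\<dots> = t (P + Q) - t ((P + Q) * qconst qi) * qconst qi - t ((P + Q) * qconst qj) * qconst qj
    - t ((P + Q) * qconst qk) * qconst qk"
    unfolding add by (simp add: t_def qcnj_add distrib_right)
  finally show ?case .
qed

section \<open>Evaluation\<close>

lemma qpoly_eval_add: "qpoly_eval (P + Q) q = qpoly_eval P q + qpoly_eval Q q"
proof -
  let ?S = "Poly_Mapping.keys P \<union> Poly_Mapping.keys Q"
  have "Poly_Mapping.keys (P + Q) \<subseteq> ?S" by (rule keys_add)
  then show ?thesis
    by (simp add: qpoly_eval_superset[where S = ?S] lookup_add distrib_left sum.distrib)
qed

lemma qpoly_eval_zero [simp]: "qpoly_eval 0 q = 0"
  by (simp add: qpoly_eval_def)

lemma qpoly_eval_uminus: "qpoly_eval (- P) q = - qpoly_eval P q"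
  using qpoly_eval_add[of P "- P" q] by (simp add: eq_neg_iff_add_eq_0 add.commute)

lemma qpoly_eval_diff: "qpoly_eval (P - Q) q = qpoly_eval P q - qpoly_eval Q q"
  using qpoly_eval_add[of P "- Q" q] by (simp add: qpoly_eval_uminus)

lemma qpoly_eval_single: "qpoly_eval (Poly_Mapping.single l a) q = monom_eval l q * a"
  by (simp add: qpoly_eval_def)

lemma monom_eval_0 [simp]: "monom_eval 0 q = 1"
proof -
  have "prod_list (map (\<lambda>i. 1) xs) = (1 :: quat)" for xs :: "'a list"
    by (induction xs) auto
  then show ?thesis by (simp add: monom_eval_def)
qed

lemma qpoly_eval_qconst [simp]: "qpoly_eval (qconst a) q = a"
  by (simp add: qconst_def qpoly_eval_single)

lemma prod_list_commute:
  fixes c :: "'a::monoid_mult"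
  assumes "\<And>x. x \<in> set xs \<Longrightarrow> c * x = x * c"
  shows "c * prod_list xs = prod_list xs * c"
  using assms
proof (induction xs)
  case (Cons x xs)
  then have x: "c * x = x * c" and xs: "c * prod_list xs = prod_list xs * c" by auto
  have "c * (x * prod_list xs) = x * (c * prod_list xs)"
    by (simp add: mult.assoc[symmetric] x)
  then show ?case by (simp add: xs mult.assoc)
qed simp

lemma power_commute:
  fixes c :: "'a::monoid_mult"
  shows "c * x = x * c \<Longrightarrow> c * x ^ k = x ^ k * c"
  using power_commuting_commutes[of x c k] by simp

text \<open>The monomial is cut at the place of \<open>q $ i\<close>: \<open>A\<close> collects the
  variables before \<open>i\<close>, \<open>B\<close> the power from \<open>l\<close> and the
  variables after it. Neither depends on \<open>k\<close>, so relations between powers of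
  \<open>q $ i\<close> carry over to monomials even if the coordinates do not commute.\<close>

lemma monom_eval_split:
  fixes q :: "quat ^ 'n::{finite,linorder}"
  obtains A B where
    "\<And>k. monom_eval (Poly_Mapping.single i k + l) q = A * (q $ i) ^ k * B"
    "\<And>c. (\<And>j. c * q $ j = q $ j * c) \<Longrightarrow> c * A = A * c"
proof -
  have "i \<in> set (sorted_list_of_set (UNIV :: 'n set))" by simp
  then obtain xs ys where split: "sorted_list_of_set (UNIV :: 'n set) = xs @ i # ys"
    by (meson split_list)
  have "distinct (xs @ i # ys)"
    unfolding split[symmetric] by simp
  then have i: "i \<notin> set xs" "i \<notin> set ys" by auto
  let ?f = "\<lambda>j. (q $ j) ^ Poly_Mapping.lookup l j"
  show ?thesis
  proof (rule that)
    fix k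
    have f: "(q $ j) ^ Poly_Mapping.lookup (Poly_Mapping.single i k + l) j = ?f j" if "j \<noteq> i" for j
      using that by (simp add: lookup_add lookup_single when_def)
    have xs: "map (\<lambda>j. (q $ j) ^ Poly_Mapping.lookup (Poly_Mapping.single i k + l) j) xs = map ?f xs"
      using i by (intro map_cong refl f) auto
    have ys: "map (\<lambda>j. (q $ j) ^ Poly_Mapping.lookup (Poly_Mapping.single i k + l) j) ys = map ?f ys"
      using i by (intro map_cong refl f) auto
    have "(q $ i) ^ Poly_Mapping.lookup (Poly_Mapping.single i k + l) i = (q $ i) ^ k * ?f i"
      by (simp add: lookup_add power_add)
    then show "monom_eval (Poly_Mapping.single i k + l) q =
        prod_list (map ?f xs) * (q $ i) ^ k * (?f i * prod_list (map ?f ys))"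
      by (simp only: monom_eval_def split map_append list.map xs ys prod_list.append prod_list.Cons mult.assoc)
  next
    fix c assume "\<And>j. c * q $ j = q $ j * c"
    then show "c * prod_list (map ?f xs) = prod_list (map ?f xs) * c"
      by (intro prod_list_commute) (auto intro: power_commute)
  qed
qed

lemma monom_eval_commute:
  assumes "\<And>i. c * q $ i = q $ i * c"
  shows "c * monom_eval l q = monom_eval l q * c"
  unfolding monom_eval_def
  by (intro prod_list_commute) (auto intro: power_commute assms)

section \<open>Points with commuting coordinates and their ideals\<close>

definition commuting :: "quat ^ 'n \<Rightarrow> bool" where
  "commuting q \<longleftrightarrow> (\<forall>i j. q $ i * q $ j = q $ j * q $ i)"

lemma monom_eval_single_add:
  assumes "commuting q"
  shows "monom_eval (Poly_Mapping.single i 1 + l) q = q $ i * monom_eval l q"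
proof -
  obtain A B where split: "\<And>k. monom_eval (Poly_Mapping.single i k + l) q = A * (q $ i) ^ k * B"
    and comm: "\<And>c. (\<And>j. c * q $ j = q $ j * c) \<Longrightarrow> c * A = A * c"
    using monom_eval_split[where q = q and i = i and l = l] by metis
  have "q $ i * A = A * q $ i"
    using assms by (intro comm) (auto simp: commuting_def)
  with split[of 0] split[of 1] show ?thesis by (simp add: mult.assoc[symmetric])
qed

lemma monom_eval_add:
  assumes "commuting q"
  shows "monom_eval (l + m) q = monom_eval l q * monom_eval m q"
  by (induction l rule: monom_induct)
     (simp_all add: monom_eval_single_add[OF assms] add.assoc mult.assoc del: One_nat_def)

lemma monom_eval_monom_eval_commute:
  assumes "commuting q"
  shows "monom_eval l q * monom_eval m q = monom_eval m q * monom_eval l q"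
  using monom_eval_add[OF assms] by (metis add.commute)

text \<open>The new powers stand to the left of the coefficients of \<open>P\<close>, and commuting
  coordinates let them move in front of the whole value. Hence vanishing at \<open>q\<close>
  survives right multiplication.\<close>

lemma qpoly_eval_mult_single:
  assumes "commuting q"
  shows "qpoly_eval (P * Poly_Mapping.single m b) q = monom_eval m q * qpoly_eval P q * b"
proof (induction P rule: qpoly_induct)
  case (single l a)
  show ?case
    by (simp add: mult_single qpoly_eval_single monom_eval_add[OF assms]
        monom_eval_monom_eval_commute[OF assms, of l m] mult.assoc)
qed (simp add: qpoly_eval_add distrib_left distrib_right)

text \<open>
  Right multiplication preserves vanishing at \<open>q\<close> only if the coordinates of \<open>q\<close> commute; in
  general this is the largest right ideal of polynomials vanishing at \<open>q\<close>.
\<close>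

definition point_ideal :: "quat ^ 'n::{finite,linorder} \<Rightarrow> 'n qpoly set" where
  "point_ideal q = {P. \<forall>Q. qpoly_eval (P * Q) q = 0}"

lemma right_ideal_point_ideal: "right_ideal (point_ideal q)"
  unfolding right_ideal_def point_ideal_def
  by (simp add: qpoly_eval_add distrib_right mult.assoc)

lemma qpoly_eval_point_ideal:
  assumes "P \<in> point_ideal q"
  shows "qpoly_eval P q = 0"
proof -
  have "qpoly_eval (P * 1) q = 0"
    using assms unfolding point_ideal_def by blast
  then show ?thesis by simp
qed

lemma subset_point_ideal:
  assumes "right_ideal I" "q \<in> zero_set I"
  shows "I \<subseteq> point_ideal q"
proof
  fix P assume "P \<in> I"
  then have "P * Q \<in> I" for Q by (rule right_ideal_mult[OF assms(1)])
  with assms(2) show "P \<in> point_ideal q"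
    unfolding point_ideal_def zero_set_def by blast
qed

lemma point_ideal_commuting:
  assumes "commuting q"
  shows "point_ideal q = {P. qpoly_eval P q = 0}"
proof -
  have mult: "qpoly_eval (P * Q) q = 0" if "qpoly_eval P q = 0" for P Q
  proof (induction Q rule: qpoly_induct)
    case (single l a)
    show ?case by (simp only: qpoly_eval_mult_single[OF assms] that mult_zero_right mult_zero_left)
  next
    case (add Q R)
    then show ?case by (simp only: distrib_left qpoly_eval_add add_0_left)
  qed
  show ?thesis
  proof (intro set_eqI iffI CollectI)
    fix P assume "P \<in> point_ideal q"
    then show "qpoly_eval P q = 0" by (rule qpoly_eval_point_ideal)
  next
    fix P assume "P \<in> {P. qpoly_eval P q = 0}"
    then have "qpoly_eval P q = 0" by (rule CollectD)
    then show "P \<in> point_ideal q"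
      unfolding point_ideal_def by (intro CollectI allI mult)
  qed
qed

text \<open>Let \<open>P\<close> carry the ideal into itself. Applied to
  \<open>qvar i - qconst (q $ i)\<close>, this says that the value of \<open>P\<close> at
  \<open>q\<close> commutes with every coordinate. Evaluation of \<open>P * R\<close> is then the
  product of the values, and quaternions have no zero divisors.\<close>

lemma completely_prime_point_ideal:
  assumes q: "commuting q"
  shows "completely_prime (point_ideal q)"
  unfolding completely_prime_def
proof (intro conjI allI impI)
  show "right_ideal (point_ideal q)" by (rule right_ideal_point_ideal)
  fix P Q assume *: "P * Q \<in> point_ideal q \<and> (\<forall>R\<in>point_ideal q. P * R \<in> point_ideal q)"
  note PQ = conjunct1[OF *] and PR = bspec[OF conjunct2[OF *]]
  let ?p = "qpoly_eval P q"
  show "P \<in> point_ideal q \<or> Q \<in> point_ideal q"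
  proof (rule ccontr)
    assume "\<not> ?thesis"
    then have p: "?p \<noteq> 0" and Q: "qpoly_eval Q q \<noteq> 0"
      by (auto simp: point_ideal_commuting[OF q])
    have comm: "?p * q $ i = q $ i * ?p" for i
    proof -
      have m: "monom_eval (Poly_Mapping.single i 1) q = q $ i"
        using monom_eval_single_add[OF q, of i 0] by simp
      have "qvar i - qconst (q $ i) \<in> point_ideal q"
        using m by (simp add: point_ideal_commuting[OF q] qvar_def qpoly_eval_diff qpoly_eval_single)
      then have "P * (qvar i - qconst (q $ i)) \<in> point_ideal q"
        by (rule PR)
      then have "qpoly_eval (P * qvar i) q = qpoly_eval (P * qconst (q $ i)) q"
        by (simp add: point_ideal_commuting[OF q] right_diff_distrib qpoly_eval_diff)
      then show ?thesis
        by (simp add: qvar_def qconst_def qpoly_eval_mult_single[OF q] m[simplified])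
    qed
    have "qpoly_eval (P * R) q = ?p * qpoly_eval R q" for R
    proof (induction R rule: qpoly_induct)
      case (single l a)
      show ?case
        using monom_eval_commute[OF comm, of l]
        by (simp add: qpoly_eval_mult_single[OF q] qpoly_eval_single mult.assoc[symmetric])
    qed (simp add: qpoly_eval_add distrib_left)
    then have "?p * qpoly_eval Q q = 0"
      using PQ by (simp add: point_ideal_commuting[OF q])
    with p Q show False by simp
  qed
qed

section \<open>Real equations satisfied by the coordinates of an arbitrary point\<close>

lemma quat_quadratic:
  fixes x :: quat
  obtains a where "x = of_real a"
  | a b :: real where "b \<noteq> 0" "x\<^sup>2 = of_real (2 * a) * x - of_real (a\<^sup>2 + b\<^sup>2)"
proof -
  define b where "b = sqrt ((q_i x)\<^sup>2 + (q_j x)\<^sup>2 + (q_k x)\<^sup>2)"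
  have b2: "b\<^sup>2 = (q_i x)\<^sup>2 + (q_j x)\<^sup>2 + (q_k x)\<^sup>2"
    by (simp add: b_def)
  show ?thesis
  proof (cases "b = 0")
    case True
    with b2 have "x = of_real (q_re x)"
      by (cases x) (simp add: of_real_quat add_nonneg_eq_0_iff)
    then show ?thesis by (rule that(1))
  next
    case False
    have "x\<^sup>2 = of_real (2 * q_re x) * x - of_real ((q_re x)\<^sup>2 + b\<^sup>2)"
      unfolding b2 by (simp add: power2_eq_square of_real_quat times_quat_def minus_quat_def algebra_simps)
    with False show ?thesis by (rule that(2))
  qed
qed

text \<open>In each monomial the powers of \<open>q $ i\<close> sit between fixed factors
  \<open>A\<close> and \<open>B\<close>. The real equation of \<open>q $ i\<close> can be applied
  there, because its real coefficients pass through both factors.\<close>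

lemma point_ideal_quadratic:
  fixes q :: "quat ^ 'n::{finite,linorder}"
  shows "(\<exists>a. qvar i - qreal a \<in> point_ideal q) \<or>
    (\<exists>a b. b \<noteq> 0 \<and> (qvar i - qreal a)\<^sup>2 + qreal (b\<^sup>2) \<in> point_ideal q)"
proof (cases "q $ i" rule: quat_quadratic)
  case (1 a)
  have "qpoly_eval ((qvar i - qreal a) * Q) q = 0" for Q
  proof (induction Q rule: qpoly_induct)
    case (single l c)
    obtain A B where "\<And>k. monom_eval (Poly_Mapping.single i k + l) q = A * (q $ i) ^ k * B"
      using monom_eval_split[where q = q and i = i and l = l] by metis
    from this[of 0] this[of 1] show ?case
      by (simp add: left_diff_distrib qvar_mult_single[simplified] qconst_mult_single qpoly_eval_diff
          qpoly_eval_single 1 of_real_def)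
  qed (simp add: distrib_left qpoly_eval_add)
  then show ?thesis unfolding point_ideal_def by blast
next
  case (2 a b)
  have N: "(qvar i - qreal a)\<^sup>2 + qreal (b\<^sup>2) =
      qvar i * qvar i - qreal (2 * a) * qvar i + qreal (a\<^sup>2 + b\<^sup>2)"
    using central_commute[OF central_qvar, of i "qreal a"]
    by (simp add: power2_eq_square algebra_simps qconst_add qconst_mult mult_2 qconst_numeral)
  have "qpoly_eval (((qvar i - qreal a)\<^sup>2 + qreal (b\<^sup>2)) * Q) q = 0" for Q
  proof (induction Q rule: qpoly_induct)
    case (single l c)
    obtain A B where split: "\<And>k. monom_eval (Poly_Mapping.single i k + l) q = A * (q $ i) ^ k * B"
      using monom_eval_split[where q = q and i = i and l = l] by metis
    have "monom_eval (Poly_Mapping.single i 1 + (Poly_Mapping.single i 1 + l)) q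
        = monom_eval (Poly_Mapping.single i 2 + l) q"
      by (simp add: add.assoc[symmetric] single_add[symmetric] numeral_2_eq_2)
    also have "\<dots> = A * (of_real (2 * a) * q $ i - of_real (a\<^sup>2 + b\<^sup>2)) * B"
      by (simp only: split 2)
    also have "\<dots> = (2 * a) *\<^sub>R (A * q $ i * B) - (a\<^sup>2 + b\<^sup>2) *\<^sub>R (A * B)"
      by (simp add: of_real_def algebra_simps)
    also have "\<dots> = (2 * a) *\<^sub>R monom_eval (Poly_Mapping.single i 1 + l) q - (a\<^sup>2 + b\<^sup>2) *\<^sub>R monom_eval l q"
      using split[of 0] split[of 1] by simp
    finally have m: "monom_eval (Poly_Mapping.single i 1 + (Poly_Mapping.single i 1 + l)) q = \<dots>" .
    show ?case
      unfolding N distrib_right left_diff_distrib mult.assoc qvar_mult_single qconst_mult_single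
        qpoly_eval_add qpoly_eval_diff qpoly_eval_single m
      by (simp add: of_real_def algebra_simps)
  qed (simp add: distrib_left qpoly_eval_add)
  with 2 show ?thesis unfolding point_ideal_def by blast
qed

section \<open>Separating points\<close>

lemma qreal_mult: "qreal a * qreal b = qreal (a * b)"
  by (simp add: qconst_mult)

lemma diff_qconst_eval:
  assumes M: "right_ideal M" and q: "commuting q"
    and var: "\<And>i. qvar i - qconst (q $ i) \<in> M"
  shows "P - qconst (qpoly_eval P q) \<in> M"
proof (induction P rule: qpoly_induct)
  case (single l a)
  show ?case
  proof (induction l arbitrary: a rule: monom_induct)
    case zero
    show ?case using right_ideal_zero[OF M] by (simp add: qpoly_eval_single qconst_def)
  next
    case (add i l)
    have comm: "monom_eval l q * q $ i = q $ i * monom_eval l q"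
      using q by (intro monom_eval_commute[symmetric]) (auto simp: commuting_def)
    \<comment> \<open>The constant \<open>q $ i\<close> is absorbed into the coefficient, so the
      induction hypothesis is applied to \<open>q $ i * a\<close>; commutativity restores the order
      of the factors in the value.\<close>
    have "(qvar i - qconst (q $ i)) * Poly_Mapping.single l a \<in> M"
      by (rule right_ideal_mult[OF M var])
    from right_ideal_add[OF M this add[of "q $ i * a"]] show ?case
      by (simp add: left_diff_distrib qvar_mult_single qconst_mult_single qpoly_eval_single
          monom_eval_single_add[OF q] mult.assoc[symmetric] comm del: One_nat_def)
  qed
next
  case (add P Q)
  from right_ideal_add[OF M add] show ?case
    by (simp add: qpoly_eval_add qconst_add algebra_simps)
qed

lemma proper_qconst:
  assumes M: "right_ideal M" and f: "f \<notin> M" and c: "qconst c \<in> M"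
  shows "c = 0"
proof (rule ccontr)
  assume "c \<noteq> 0"
  have "qconst c * (qconst (inverse c) * f) \<in> M"
    by (rule right_ideal_mult[OF M c])
  also have "qconst c * (qconst (inverse c) * f) = f"
    using \<open>c \<noteq> 0\<close> by (simp add: mult.assoc[symmetric] qconst_mult[symmetric])
  finally show False using f by simp
qed

lemma point_ideal_of_congruences:
  assumes M: "right_ideal M" and f: "f \<notin> M" and q: "commuting q"
    and var: "\<And>i. qvar i - qconst (q $ i) \<in> M"
  shows "M \<subseteq> point_ideal q" "f \<notin> point_ideal q"
proof -
  have iff: "P \<in> M \<longleftrightarrow> qpoly_eval P q = 0" for P
    using right_ideal_cong[OF M diff_qconst_eval[OF M q var]] proper_qconst[OF M f]
      right_ideal_zero[OF M] by force
  show "M \<subseteq> point_ideal q" "f \<notin> point_ideal q"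
    using iff f by (auto simp: point_ideal_commuting[OF q])
qed

text \<open>An elementary form of the semisimplicity argument. Take \<open>M\<close> maximal among
  the right ideals that contain \<open>K\<close> and avoid \<open>f\<close>. It suffices to find
  commuting constants congruent to the variables, since membership in \<open>M\<close> then means
  vanishing at that point. Either all variables are congruent to reals, or one of them supplies an
  imaginary unit modulo \<open>M\<close>.\<close>

lemma separating_point:
  fixes K :: "'n::{finite,linorder} qpoly set"
  assumes K: "right_ideal K" "f \<notin> K"
    and quad: "\<And>i. (\<exists>a. qvar i - qreal a \<in> K) \<or>
      (\<exists>a b. b \<noteq> 0 \<and> (qvar i - qreal a)\<^sup>2 + qreal (b\<^sup>2) \<in> K)"
  obtains q where "commuting q" "K \<subseteq> point_ideal q" "f \<notin> point_ideal q"
proof -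
  have disj: "K \<inter> {f} = {}" using K(2) by simp
  obtain M where M: "right_ideal M" and KM: "K \<subseteq> M" and f0: "M \<inter> {f} = {}"
    and max: "\<And>N. right_ideal N \<Longrightarrow> M \<subseteq> N \<Longrightarrow> N \<inter> {f} = {} \<Longrightarrow> N = M"
    and gen0: "\<And>g. g \<notin> M \<Longrightarrow> \<exists>Q. \<exists>s\<in>{f}. s - g * Q \<in> M"
    using maximal_right_ideal_avoiding[OF K(1) disj] by metis
  have f: "f \<notin> M" using f0 by simp
  have gen: "\<exists>Q. f - g * Q \<in> M" if "g \<notin> M" for g
    using gen0[OF that] by simp
  note zero = proper_qconst[OF M f]
  have central_in: "W * c * P \<in> M" if "central c" "c \<in> M" for c W P
    using right_ideal_mult[OF M that(2), of "W * P"] central_commute[OF that(1), of W]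
    by (simp add: mult.assoc[symmetric])
  \<comment> \<open>If the colon ideal of a central \<open>c\<close> also avoids \<open>f\<close>,
    maximality makes it equal to \<open>M\<close>, so \<open>c\<close> can be cancelled.\<close>
  have colon: "d \<in> M" if "central c" "c * d \<in> M" "c * f \<notin> M" for c d
  proof -
    have "M \<subseteq> {P. c * P \<in> M}"
      using right_ideal_central_mult[OF M that(1)] by blast
    then have "{P. c * P \<in> M} = M"
      using that(3) by (intro max right_ideal_colon[OF M that(1)]) auto
    then show "d \<in> M" using that(2) by blast
  qed
  have "\<exists>q. commuting q \<and> (\<forall>i. qvar i - qconst (q $ i) \<in> M)"
  proof (cases "\<forall>i. \<exists>a. qvar i - qreal a \<in> M")
    case True
    then obtain a where a: "\<And>i. qvar i - qreal (a i) \<in> M" by metis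
    have "commuting (\<chi> i. of_real (a i))"
      by (simp add: commuting_def of_real_def mult.commute)
    with a show ?thesis by (intro exI[of _ "\<chi> i. of_real (a i)"]) simp
  next
    case False
    then obtain i0 where "\<And>a. qvar i0 - qreal a \<notin> M" by blast
    then obtain a0 b0 where b0: "b0 \<noteq> 0" "(qvar i0 - qreal a0)\<^sup>2 + qreal (b0\<^sup>2) \<in> M"
      using quad[of i0] KM by blast
    txt \<open>Modulo \<open>M\<close>, \<open>J\<close> is a central square root of \<open>-1\<close> and every variable is real affine in \<open>J\<close>.\<close>
    define c where "c = 1 / b0"
    define J where "J = qreal c * (qvar i0 - qreal a0)"
    have J: "central J"
      unfolding J_def by (intro central_mult central_diff central_qreal central_qvar)
    note Jc = central_commute[OF J]
    have Jr: "J * qreal r = qreal r * J" "J * (qreal r * P) = qreal r * (J * P)" for r P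
      using Jc[of "qreal r"] by (simp_all add: mult.assoc[symmetric])
    have "J * J = qreal c * (qreal c * (qvar i0 - qreal a0)\<^sup>2)"
      using Jr(2)[of c "qvar i0 - qreal a0"]
      by (simp add: J_def power2_eq_square mult.assoc)
    moreover have "(qreal c :: 'n qpoly) * (qreal c * qreal (b0\<^sup>2)) = qreal (c * (c * b0\<^sup>2))"
      by (simp only: qreal_mult)
    moreover have "c * (c * b0\<^sup>2) = 1"
      using b0(1) by (simp add: c_def power2_eq_square)
    ultimately have "J * J + 1 = qreal c * (qreal c * ((qvar i0 - qreal a0)\<^sup>2 + qreal (b0\<^sup>2)))"
      by (simp only: distrib_left of_real_1 qconst_1)
    then have JJ: "J * J + 1 \<in> M"
      using right_ideal_central_mult[OF M central_qreal right_ideal_central_mult[OF M central_qreal b0(2)]]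
      by simp
    have JJc: "central (J * J + 1)" by (intro central_add central_mult J central_one)
    have lin: "\<exists>a b. qvar i - (qreal a + qreal b * J) \<in> M" for i
    proof (cases "\<exists>a. qvar i - qreal a \<in> M")
      case True
      then obtain a where "qvar i - qreal a \<in> M" ..
      then show ?thesis by (intro exI[of _ a] exI[of _ 0]) simp
    next
      case False
      then obtain a b where b: "b \<noteq> 0" "(qvar i - qreal a)\<^sup>2 + qreal (b\<^sup>2) \<in> M"
        using quad[of i] KM by blast
      define A where "A = qvar i - qreal a"
      define B where "B = qreal b * J"
      have A: "central A" and B: "central B"
        unfolding A_def B_def by (intro central_diff central_mult central_qreal central_qvar J)+
      have BB: "B * B = qreal (b\<^sup>2) * (J * J)"
        by (simp add: B_def power2_eq_square qconst_mult mult.assoc Jr)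
      have "(A - B) * (A + B) = A\<^sup>2 + qreal (b\<^sup>2) - qreal (b\<^sup>2) * (J * J + 1)"
        using central_commute[OF A, of B] BB by (simp add: algebra_simps power2_eq_square)
      moreover have "\<dots> \<in> M"
        using b(2) right_ideal_central_mult[OF M central_qreal JJ]
        unfolding A_def by (intro right_ideal_diff[OF M])
      ultimately have mp: "(A - B) * (A + B) \<in> M" by simp
      have pm: "(A + B) * (A - B) \<in> M"
        using mp central_commute[OF central_add[OF A B], of "A - B"] by simp
      \<comment> \<open>If neither factor lies in \<open>M\<close>, \<open>colon\<close> puts both
        products with \<open>f\<close> into \<open>M\<close>. Their difference is
        \<open>2 * B * f\<close>, and \<open>B\<close> is invertible modulo \<open>M\<close> because
        \<open>b\<close> is nonzero and \<open>J * J\<close> is congruent to -1; so \<open>f\<close>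
        would lie in \<open>M\<close>.\<close>
      have "A - B \<in> M \<or> A + B \<in> M"
      proof (rule ccontr)
        assume "\<not> ?thesis"
        then have "(A - B) * f \<in> M" "(A + B) * f \<in> M"
          using colon[OF central_diff[OF A B] mp] colon[OF central_add[OF A B] pm] by blast+
        then have "(A + B) * f - (A - B) * f \<in> M" by (intro right_ideal_diff[OF M])
        also have "(A + B) * f - (A - B) * f = qreal (2 * b) * (J * f)"
          by (simp add: B_def algebra_simps qconst_mult qconst_numeral mult_2)
        finally have "J * (qreal (- 1 / (2 * b)) * (qreal (2 * b) * (J * f))) \<in> M"
          by (rule right_ideal_central_mult[OF M J right_ideal_central_mult[OF M central_qreal]])
        also have "qreal (- 1 / (2 * b)) * (qreal (2 * b) * (J * f)) = - (J * f)"
        proof -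
          have "- 1 / (2 * b) * (2 * b) = (- 1 :: real)" using b(1) by simp
          then have "(qreal (- 1 / (2 * b)) :: 'n qpoly) * qreal (2 * b) = qreal (- 1)"
            by (simp only: qreal_mult)
          also have "\<dots> = - 1" by (simp add: qconst_minus)
          finally show ?thesis by (simp only: mult.assoc[symmetric]) simp
        qed
        finally have "J * - (J * f) + (J * J + 1) * f \<in> M"
          using right_ideal_mult[OF M JJ] by (intro right_ideal_add[OF M])
        then show False using f by (simp add: algebra_simps)
      qed
      then show ?thesis
      proof
        assume "A - B \<in> M"
        then show ?thesis by (intro exI[of _ a] exI[of _ b]) (simp add: A_def B_def diff_diff_eq)
      next
        assume "A + B \<in> M"
        then show ?thesis
          by (intro exI[of _ a] exI[of _ "-b"]) (simp add: A_def B_def qconst_minus algebra_simps)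
      qed
    qed
    \<comment> \<open>The left factor \<open>W\<close> is included because \<open>M\<close> is not
      closed under left multiplication, whereas the congruence for \<open>Q\<close> below has to be
      multiplied from the left by \<open>J - qconst e\<close>.\<close>
    have normal_form: "\<exists>h k. \<forall>W. W * (P - (qconst h + J * qconst k)) \<in> M" for P
    proof (induction P rule: qpoly_induct)
      case (single l a)
      show ?case
      proof (induction l arbitrary: a rule: monom_induct)
        case zero
        show ?case
          by (intro exI[of _ a] exI[of _ 0]) (simp add: qconst_def right_ideal_zero[OF M])
      next
        case (add i l)
        let ?S = "Poly_Mapping.single l a"
        obtain h k where hk: "\<And>W. W * (?S - (qconst h + J * qconst k)) \<in> M"
          using add[of a] by blast
        obtain \<alpha> \<beta> where D: "qvar i - (qreal \<alpha> + qreal \<beta> * J) \<in> M" using lin[of i] by blast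
        have Dc: "central (qvar i - (qreal \<alpha> + qreal \<beta> * J))"
          by (intro central_diff central_add central_mult central_qreal central_qvar J)
        \<comment> \<open>Expand \<open>(\<alpha> + \<beta> * J) * (h + J * k)\<close> with
          \<open>J * J\<close> replaced by -1.\<close>
        define h' where "h' = of_real \<alpha> * h - of_real \<beta> * k"
        define k' where "k' = of_real \<alpha> * k + of_real \<beta> * h"
        have "qvar i * ?S - (qconst h' + J * qconst k') =
            qvar i * (?S - (qconst h + J * qconst k))
            + (qvar i - (qreal \<alpha> + qreal \<beta> * J)) * (qconst h + J * qconst k)
            + qreal \<beta> * (J * J + 1) * qconst k"
          by (simp add: h'_def k'_def algebra_simps qconst_add qconst_diff qconst_mult Jr)
        then have eq: "W * (qvar i * ?S - (qconst h' + J * qconst k')) =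
            W * qvar i * (?S - (qconst h + J * qconst k))
            + W * (qvar i - (qreal \<alpha> + qreal \<beta> * J)) * (qconst h + J * qconst k)
            + W * qreal \<beta> * (J * J + 1) * qconst k" for W
          by (simp only:) (simp add: distrib_left distrib_right mult.assoc)
        have "W * (qvar i * ?S - (qconst h' + J * qconst k')) \<in> M" for W
          unfolding eq by (intro right_ideal_add[OF M] hk central_in[OF Dc D] central_in[OF JJc JJ])
        then show ?case unfolding qvar_mult_single by blast
      qed
    next
      case (add P Q)
      then obtain h k h' k' where P: "\<And>W. W * (P - (qconst h + J * qconst k)) \<in> M"
        and Q: "\<And>W. W * (Q - (qconst h' + J * qconst k')) \<in> M" by blast
      have "W * (P + Q - (qconst (h + h') + J * qconst (k + k'))) =
          W * (P - (qconst h + J * qconst k)) + W * (Q - (qconst h' + J * qconst k'))" for W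
        by (simp add: algebra_simps qconst_add)
      then have "W * (P + Q - (qconst (h + h') + J * qconst (k + k'))) \<in> M" for W
        using right_ideal_add[OF M P Q] by simp
      then show ?case by blast
    qed
    txt \<open>
      If no \<open>J - u\<close> lies in \<open>M\<close>, maximality of \<open>M\<close> gives \<open>f \<equiv> (J - e) * f1\<close> both for \<open>e = qi\<close> and
      for \<open>e = qj\<close>, with the same constant \<open>f1\<close>.
    \<close>
    have "\<exists>u. J - qconst u \<in> M"
    proof (rule ccontr)
      assume no: "\<not> ?thesis"
      obtain f0 f1 where "\<And>W. W * (f - (qconst f0 + J * qconst f1)) \<in> M"
        using normal_form[of f] by blast
      from this[of 1] have f01: "f - (qconst f0 + J * qconst f1) \<in> M" by simp
      have f0: "f0 = - (e * f1)" if e: "e * e = -1" for e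
      proof -
        obtain Q where Q: "f - (J - qconst e) * Q \<in> M"
          using gen[of "J - qconst e"] no by blast
        obtain h k where "\<And>W. W * (Q - (qconst h + J * qconst k)) \<in> M"
          using normal_form[of Q] by blast
        then have Q': "(J - qconst e) * (Q - (qconst h + J * qconst k)) \<in> M" .
        \<comment> \<open>After left multiplication by \<open>J - qconst e\<close>, the element
          \<open>J * qconst k\<close> may be replaced by \<open>- qconst e * qconst k\<close>. So
          \<open>f\<close> is congruent to \<open>(J - qconst e) * qconst w\<close>.\<close>
        define w where "w = h - e * k"
        have ee: "(qconst e :: 'n qpoly) * qconst e = -1"
          using e by (simp flip: qconst_mult add: qconst_minus)
        have "(J - qconst e) * (J * qconst k + qconst e * qconst k) = (J * J + 1) * qconst k"
          using ee Jc[of "qconst e"] by (simp add: algebra_simps) (simp add: mult.assoc[symmetric])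
        then have w: "(J - qconst e) * (J * qconst k + qconst e * qconst k) \<in> M"
          using right_ideal_mult[OF M JJ] by simp
        have "(f - (J - qconst e) * Q) + (J - qconst e) * (Q - (qconst h + J * qconst k))
          + (J - qconst e) * (J * qconst k + qconst e * qconst k) - (f - (qconst f0 + J * qconst f1)) \<in> M"
          by (intro right_ideal_add[OF M] right_ideal_diff[OF M] Q Q' w f01)
        also have "(f - (J - qconst e) * Q) + (J - qconst e) * (Q - (qconst h + J * qconst k))
          + (J - qconst e) * (J * qconst k + qconst e * qconst k) - (f - (qconst f0 + J * qconst f1))
          = qconst (f0 + e * w) + J * qconst (f1 - w)"
          by (simp add: w_def qconst_add qconst_diff qconst_mult algebra_simps)
        finally have *: "qconst (f0 + e * w) + J * qconst (f1 - w) \<in> M" .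
        \<comment> \<open>Otherwise the relation \<open>*\<close>, divided on the right by the
          coefficient of \<open>J\<close>, makes \<open>J\<close> congruent to a constant.\<close>
        have "f1 = w"
        proof (rule ccontr)
          assume "f1 \<noteq> w"
          let ?v = "inverse (f1 - w)"
          have "(qconst (f0 + e * w) + J * qconst (f1 - w)) * qconst ?v \<in> M"
            by (rule right_ideal_mult[OF M *])
          also have "(qconst (f0 + e * w) + J * qconst (f1 - w)) * qconst ?v
            = qconst ((f0 + e * w) * ?v) + J * qconst ((f1 - w) * ?v)"
            unfolding qconst_mult[of "f0 + e * w"] qconst_mult[of "f1 - w"]
            by (simp only: distrib_right mult.assoc)
          also have "\<dots> = J - qconst (- ((f0 + e * w) * ?v))"
            using \<open>f1 \<noteq> w\<close> by (simp add: qconst_minus)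
          finally show False using no by blast
        qed
        with * have "f0 + e * w = 0" by (intro zero) simp
        with \<open>f1 = w\<close> show ?thesis by (simp add: eq_neg_iff_add_eq_0)
      qed
      have qi: "qi * qi = -1" and qj: "qj * qj = -1" by (simp_all add: quat_basis_defs quat_defs)
      have "- (qi * f1) = - (qj * f1)"
        using f0[OF qi] f0[OF qj] by (rule trans[OF sym])
      then have "qi * f1 = qj * f1" by simp
      then have "(qi - qj) * f1 = 0" by (simp add: left_diff_distrib)
      moreover have "qi - qj \<noteq> 0" by (simp add: quat_basis_defs quat_defs)
      ultimately have "f1 = 0" by simp
      with f0[OF qi] have "f0 = 0" by simp
      with \<open>f1 = 0\<close> f01 f show False by simp
    qed
    then obtain u where u: "J - qconst u \<in> M" ..
    obtain a b where ab: "\<And>i. qvar i - (qreal (a i) + qreal (b i) * J) \<in> M"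
      using lin by metis
    \<comment> \<open>All coordinates are real affine in the single quaternion \<open>u\<close>,
      hence commute.\<close>
    define q :: "quat ^ 'n::{finite,linorder}" where "q = (\<chi> i. of_real (a i) + of_real (b i) * u)"
    have "commuting q"
      by (simp add: commuting_def q_def of_real_def algebra_simps)
    moreover have "qvar i - qconst (q $ i) \<in> M" for i
    proof -
      have "(qvar i - (qreal (a i) + qreal (b i) * J)) + qreal (b i) * (J - qconst u) \<in> M"
        by (intro right_ideal_add[OF M] ab right_ideal_central_mult[OF M central_qreal] u)
      then show ?thesis by (simp add: q_def qconst_add qconst_mult algebra_simps)
    qed
    ultimately show ?thesis by blast
  qed
  then obtain q where q: "commuting q" "\<And>i. qvar i - qconst (q $ i) \<in> M" by blast
  note point_ideal_of_congruences[OF M f q]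
  with q(1) KM show ?thesis by (intro that[of q]) auto
qed

section \<open>Completely prime right ideals\<close>

text \<open>
  Otherwise all norms of elements of \<open>f * Q + L\<close> lie in \<open>L\<close>; polarizing,
  \<open>qcnj (f * c)\<close> multiplies \<open>L\<close> into itself for every constant \<open>c\<close>, so it lies in \<open>L\<close> by
  complete primeness, and then so does \<open>f\<close>.
\<close>

lemma completely_prime_central_multiple:
  fixes L :: "'n qpoly set"
  assumes prime: "completely_prime L" and f: "f \<notin> L"
  obtains Q z where "central z" "z \<notin> L" "f * Q - z \<in> L"
proof (rule ccontr)
  assume "\<not> thesis"
  with that have neg: "\<And>Q z. central z \<Longrightarrow> f * Q - z \<in> L \<Longrightarrow> z \<in> L" by blast
  have L: "right_ideal L"
    and CP: "\<And>P Q. P * Q \<in> L \<Longrightarrow> (\<And>R. R \<in> L \<Longrightarrow> P * R \<in> L) \<Longrightarrow> P \<in> L \<or> Q \<in> L"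
    using prime unfolding completely_prime_def by blast+
  have half: "P \<in> L" if "2 * P \<in> L" for P
  proof -
    have "2 * P * qreal (1/2) \<in> L" by (rule right_ideal_mult[OF L that])
    also have "2 * P * qreal (1/2) = qreal (1/2) * qreal 2 * P"
      using central_commute[OF central_qreal, of "1/2" "2 * P"]
      by (simp add: qconst_numeral mult.assoc)
    also have "\<dots> = P"
      by (simp only: qreal_mult) simp
    finally show ?thesis .
  qed
  have cnj: "qcnj (f * qconst c) \<in> L" if c: "c \<noteq> 0" for c
  proof -
    define g where "g = f * qconst c"
    have "g \<notin> L"
    proof
      assume "g \<in> L"
      then have "g * qconst (inverse c) \<in> L" by (rule right_ideal_mult[OF L])
      with c f show False by (simp add: g_def mult.assoc flip: qconst_mult)
    qed
    \<comment> \<open>The norm is central and congruent modulo \<open>L\<close> to a right multiple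
      of \<open>f\<close>, so the assumption \<open>neg\<close> applies.\<close>
    have norm: "(g * Q + l) * qcnj (g * Q + l) \<in> L" if "l \<in> L" for Q l
    proof (rule neg[OF central_norm])
      have "f * (qconst c * Q * qcnj (g * Q + l)) - (g * Q + l) * qcnj (g * Q + l)
          = - (l * qcnj (g * Q + l))"
        by (simp add: g_def algebra_simps)
      also have "\<dots> \<in> L" by (intro right_ideal_uminus[OF L] right_ideal_mult[OF L] that)
      finally show "f * (qconst c * Q * qcnj (g * Q + l)) - (g * Q + l) * qcnj (g * Q + l) \<in> L" .
    qed
    \<comment> \<open>Polarization: subtract the norms of \<open>g * Q\<close> and \<open>l\<close>
      from the norm of their sum.\<close>
    have trace: "qcnj l * g * Q + qcnj (qcnj l * g * Q) \<in> L" if l: "l \<in> L" for l Q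
    proof -
      let ?h = "g * Q"
      have eq: "qcnj (?h + l) * (?h + l) - qcnj ?h * ?h - qcnj l * l = qcnj l * ?h + qcnj (qcnj l * ?h)"
        by (simp add: qcnj_add qcnj_mult algebra_simps)
      have "?h * qcnj ?h \<in> L"
        using norm[OF right_ideal_zero[OF L], of Q] by simp
      then have "qcnj (?h + l) * (?h + l) - qcnj ?h * ?h - qcnj l * l \<in> L"
        unfolding qcnj_mult_self
        by (intro right_ideal_diff[OF L] norm[OF l] right_ideal_mult[OF L l])
      then show ?thesis
        unfolding eq by (simp add: mult.assoc)
    qed
    \<comment> \<open>All traces of right multiples of \<open>w\<close> lie in \<open>L\<close>,
      hence so does \<open>w\<close>. Subtracting \<open>w\<close> from its trace leaves
      \<open>qcnj w\<close>, which is \<open>qcnj g * l\<close>.\<close>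
    have "qcnj g * l \<in> L" if "l \<in> L" for l
    proof -
      define w where "w = qcnj l * g"
      have tw: "w * Q + qcnj (w * Q) \<in> L" for Q
        using trace[OF that, of Q] by (simp add: w_def)
      have "2 * w \<in> L"
        unfolding qpoly_conv_traces[of w]
        using tw tw[of 1] by (intro right_ideal_diff[OF L] right_ideal_mult[OF L]) simp_all
      then have "(w + qcnj w) - w \<in> L"
        using tw[of 1] half by (intro right_ideal_diff[OF L]) simp_all
      then show ?thesis by (simp add: w_def qcnj_mult)
    qed
    moreover have "qcnj g * g \<in> L"
      using norm[OF right_ideal_zero[OF L], of 1] by (simp add: qcnj_mult_self)
    ultimately show ?thesis
      using CP[of "qcnj g" g] \<open>g \<notin> L\<close> g_def by blast
  qed
  \<comment> \<open>The constants were kept arbitrary in \<open>cnj\<close> because conjugation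
    turns them into left factors of \<open>x\<close>; these multiples are what
    \<open>qcnj_conv\<close> needs to recover \<open>f = qcnj x\<close>.\<close>
  define x where "x = qcnj f"
  have x: "qconst c * x \<in> L" if "c \<noteq> 0" for c
  proof -
    have "quat_cnj c \<noteq> 0" using that quat_cnj_cnj[of c] by auto
    from cnj[OF this] show ?thesis
      by (simp add: x_def qcnj_mult quat_cnj_cnj qconst_def)
  qed
  have "qi \<noteq> 0" "qj \<noteq> 0" "qk \<noteq> 0" by (simp_all add: quat_basis_defs quat_defs)
  then have "qconst qi * x * qconst qi \<in> L" "qconst qj * x * qconst qj \<in> L"
    "qconst qk * x * qconst qk \<in> L"
    by (simp_all add: right_ideal_mult[OF L x])
  then have "2 * qcnj x \<in> L"
    unfolding qcnj_conv[of x]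
    using x[of 1] by (intro right_ideal_uminus[OF L] right_ideal_add[OF L]) simp_all
  then have "f \<in> L" using half by (simp add: x_def)
  with f show False ..
qed

text \<open>A central \<open>z\<close> multiplies \<open>L\<close> into itself, so complete
  primeness applies to \<open>z * z ^ k\<close>; for \<open>k = 0\<close>, the ideal is proper as it
  misses \<open>z\<close>.\<close>

lemma completely_prime_central_power:
  assumes "completely_prime L" "central z" "z \<notin> L"
  shows "z ^ k \<notin> L"
proof (induction k)
  case 0
  show ?case
  proof
    assume "z ^ 0 \<in> L"
    moreover have "right_ideal L" using assms(1) by (simp add: completely_prime_def)
    ultimately have "1 * z \<in> L" using right_ideal_mult by fastforce
    with assms(3) show False by simp
  qed
next
  case (Suc k)
  have "\<forall>R\<in>L. z * R \<in> L"
    using assms(1,2) unfolding completely_prime_def by (auto intro: right_ideal_central_mult)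
  with Suc assms show ?case unfolding completely_prime_def by auto
qed

section \<open>Algebraicity modulo a right ideal\<close>

text \<open>Horner evaluation at \<open>T\<close>. As real constants are central, it is a ring
  homomorphism in the real polynomial.\<close>

definition qpoly_subst :: "'n qpoly \<Rightarrow> real poly \<Rightarrow> 'n qpoly" where
  "qpoly_subst T p = fold_coeffs (\<lambda>a P. qreal a + T * P) p 0"

lemma qpoly_subst_0 [simp]: "qpoly_subst T 0 = 0"
  by (simp add: qpoly_subst_def)

lemma qpoly_subst_pCons: "qpoly_subst T (pCons a p) = qreal a + T * qpoly_subst T p"
  by (cases "a = 0 \<and> p = 0") (auto simp: qpoly_subst_def)

lemma qpoly_subst_add: "qpoly_subst T (p + r) = qpoly_subst T p + qpoly_subst T r"
proof (induction p r rule: poly_induct2)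
  case (pCons a p b r)
  then show ?case by (simp add: qpoly_subst_pCons qconst_add distrib_left ac_simps)
qed simp

lemma qpoly_subst_smult: "qpoly_subst T (smult a p) = qreal a * qpoly_subst T p"
proof (induction p)
  case (pCons b p)
  have "T * (qreal a * P) = qreal a * (T * P)" for P
    using central_commute[OF central_qreal, of a T] by (simp add: mult.assoc[symmetric])
  with pCons show ?case by (simp add: qpoly_subst_pCons qconst_mult distrib_left mult.assoc)
qed simp

lemma qpoly_subst_mult: "qpoly_subst T (p * r) = qpoly_subst T p * qpoly_subst T r"
proof (induction p)
  case (pCons a p)
  then show ?case
    by (simp add: qpoly_subst_pCons qpoly_subst_add qpoly_subst_smult distrib_right mult.assoc)
qed simp

lemma qpoly_subst_sum: "qpoly_subst T (sum f A) = (\<Sum>a\<in>A. qpoly_subst T (f a))"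
  by (induction A rule: infinite_finite_induct) (simp_all add: qpoly_subst_add)

lemma central_qpoly_subst: "central T \<Longrightarrow> central (qpoly_subst T p)"
  by (induction p) (auto simp: qpoly_subst_pCons intro: central_add central_mult central_qreal central_zero)

text \<open>Take a complex root \<open>w\<close>. If it is not real, divide by the real quadratic
  with roots \<open>w\<close> and its conjugate: the remainder is real of degree at most one and
  vanishes at \<open>w\<close>, so it is zero.\<close>

lemma real_poly_quadratic_factor:
  fixes h :: "real poly"
  assumes "degree h > 0"
  obtains a s where "h = [:- a, 1:] * s"
  | a b s where "b \<noteq> 0" "h = [:a\<^sup>2 + b\<^sup>2, - 2 * a, 1:] * s"
proof -
  let ?H = "map_poly complex_of_real h"
  have "degree ?H = degree h" by (rule degree_map_poly) simp
  with assms have "\<not> constant (poly ?H)" by (simp add: constant_degree)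
  then obtain w where w: "poly ?H w = 0" using fundamental_theorem_of_algebra by blast
  show ?thesis
  proof (cases "Im w = 0")
    case True
    then have "w = of_real (Re w)" by (simp add: complex_eq_iff)
    moreover have "poly ?H (of_real x) = of_real (poly h x)" for x
      by (induction h) (auto simp: map_poly_pCons)
    ultimately have "poly h (Re w) = 0"
      using w by (metis of_real_eq_0_iff)
    then have "[:- Re w, 1:] dvd h" by (simp add: poly_eq_0_iff_dvd)
    then show ?thesis using that(1) by (auto elim: dvdE)
  next
    case False
    let ?d = "[:(Re w)\<^sup>2 + (Im w)\<^sup>2, - 2 * Re w, 1:]"
    define r where "r = h mod ?d"
    have h: "h = ?d * (h div ?d) + r"
      unfolding r_def by (rule mult_div_mod_eq[symmetric])
    have "degree r < 2"
      using degree_mod_less'[of ?d h] by (cases "r = 0") (auto simp: r_def)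
    obtain a r' where r1: "r = pCons a r'" by (cases r)
    obtain b r'' where r2: "r' = pCons b r''" by (cases r')
    have "r'' = 0"
      using \<open>degree r < 2\<close> unfolding r1 r2 by (auto split: if_splits)
    have mult: "map_poly complex_of_real (p * s) = map_poly of_real p * map_poly of_real s" for p s
      by (intro poly_eqI) (simp add: coeff_map_poly coeff_mult)
    have add: "map_poly complex_of_real (p + s) = map_poly of_real p + map_poly of_real s" for p s
      by (intro poly_eqI) (simp add: coeff_map_poly)
    have "map_poly complex_of_real h = map_poly of_real ?d * map_poly of_real (h div ?d) + map_poly of_real r"
      by (subst h) (simp only: add mult)
    moreover have "poly (map_poly complex_of_real ?d) w = 0"
      by (simp add: map_poly_pCons complex_eq_iff algebra_simps power2_eq_square)
    ultimately have "poly (map_poly complex_of_real r) w = 0"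
      using w by (simp only: poly_add poly_mult mult_zero_left add_0_left)
    then have "of_real a + w * of_real b = 0"
      by (simp add: r1 r2 \<open>r'' = 0\<close> map_poly_pCons)
    then have "b = 0" "a = 0"
      using False by (auto simp: complex_eq_iff)
    then have "h = ?d * (h div ?d)"
      using h by (simp add: r1 r2 \<open>r'' = 0\<close>)
    then show ?thesis using False that(2) by blast
  qed
qed

text \<open>Induction on the degree. Primeness puts into \<open>M\<close> either the split-off
  factor at \<open>T\<close>, which is the claim, or the cofactor of smaller degree; a proper right
  ideal contains no nonzero constant.\<close>

lemma quadratic_in_prime:
  assumes M: "right_ideal M" "1 \<notin> M"
    and prime: "\<And>c d. central c \<Longrightarrow> central d \<Longrightarrow> c * d \<in> M \<Longrightarrow> c \<in> M \<or> d \<in> M"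
    and T: "central T"
    and h: "qpoly_subst T h \<in> M" "h \<noteq> 0"
  shows "(\<exists>a. T - qreal a \<in> M) \<or> (\<exists>a b. b \<noteq> 0 \<and> (T - qreal a)\<^sup>2 + qreal (b\<^sup>2) \<in> M)"
  using h
proof (induction "degree h" arbitrary: h rule: less_induct)
  case less
  show ?case
  proof (cases "degree h = 0")
    case True
    then obtain c where "h = [:c:]" by (rule degree_eq_zeroE)
    with less.prems have "qreal c \<in> M" "c \<noteq> 0" by (auto simp: qpoly_subst_pCons)
    with proper_qconst[OF M(1) M(2), of "of_real c"] show ?thesis by simp
  next
    case False
    note split = prime[OF central_qpoly_subst[OF T] central_qpoly_subst[OF T]]
    from False have "degree h > 0" by simp
    then show ?thesis
    proof (cases rule: real_poly_quadratic_factor)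
      case (1 a s)
      have "s \<noteq> 0" using 1 less.prems(2) by auto
      then have "degree h = Suc (degree s)"
        unfolding 1 by (subst degree_mult_eq) auto
      with \<open>s \<noteq> 0\<close> have s: "s \<noteq> 0" "degree s < degree h" by auto
      have T: "qpoly_subst T [:- a, 1:] = T - qreal a"
        by (simp add: qpoly_subst_pCons qconst_minus)
      have "qpoly_subst T [:- a, 1:] * qpoly_subst T s \<in> M"
        using less.prems(1) by (simp only: 1 qpoly_subst_mult)
      from split[OF this] show ?thesis
        unfolding T using less.hyps[OF s(2) _ s(1)] by blast
    next
      case (2 a b s)
      have "s \<noteq> 0" using 2(2) less.prems(2) by auto
      then have "degree h = 2 + degree s"
        unfolding 2(2) by (subst degree_mult_eq) auto
      with \<open>s \<noteq> 0\<close> have s: "s \<noteq> 0" "degree s < degree h" by auto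
      have "T * qreal a = qreal a * T" by (rule central_commute[OF T])
      then have sq: "(T - qreal a)\<^sup>2 + qreal (b\<^sup>2) =
          qreal (a\<^sup>2 + b\<^sup>2) + T * (- (qreal a + qreal a) + T)"
        by (simp add: power2_eq_square algebra_simps qconst_add qconst_mult)
      have "- 2 * a = - (a + a)" by simp
      then have double: "qreal (- 2 * a) = - (qreal a + qreal a)"
        by (simp only: of_real_minus of_real_add qconst_minus qconst_add)
      have T: "qpoly_subst T [:a\<^sup>2 + b\<^sup>2, - 2 * a, 1:] = (T - qreal a)\<^sup>2 + qreal (b\<^sup>2)"
        unfolding sq double[symmetric] by (simp only: qpoly_subst_pCons) simp
      have "qpoly_subst T [:a\<^sup>2 + b\<^sup>2, - 2 * a, 1:] * qpoly_subst T s \<in> M"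
        using less.prems(1) by (simp only: 2(2) qpoly_subst_mult)
      from split[OF this] show ?thesis
        unfolding T using less.hyps[OF s(2) _ s(1)] 2(1) by blast
    qed
  qed
qed

text \<open>
  The elements \<open>Q a\<close> with \<open>(T - a) * Q a \<equiv> z ^ k a\<close> modulo \<open>M\<close> form an uncountable family in a
  space of countable dimension, so there is a real linear relation between those with a common
  exponent \<open>k a\<close>. Clearing the denominators \<open>T - a\<close> turns it into an algebraic equation for \<open>T\<close>.
\<close>

lemma algebraic_modulo:
  fixes M :: "'n::finite qpoly set"
  assumes M: "right_ideal M"
    and z: "\<And>k. z ^ k \<notin> M"
    and gen: "\<And>g. g \<notin> M \<Longrightarrow> \<exists>Q k. z ^ k - g * Q \<in> M"
    and prime: "\<And>c d. central c \<Longrightarrow> c * d \<in> M \<Longrightarrow> c \<in> M \<or> d \<in> M"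
    and T: "central T"
  obtains h where "h \<noteq> 0" "qpoly_subst T h \<in> M"
proof (rule ccontr)
  assume "\<not> thesis"
  with that have no: "\<And>h. h \<noteq> 0 \<Longrightarrow> qpoly_subst T h \<notin> M" by blast
  have lin: "qpoly_subst T [:- a, 1:] = T - qreal a" for a
    by (simp add: qpoly_subst_pCons qconst_minus)
  have "\<exists>Q k. z ^ k - (T - qreal a) * Q \<in> M" for a
    using no[of "[:- a, 1:]"] by (intro gen) (simp add: lin)
  then obtain Q k where Qk: "\<And>a. z ^ k a - (T - qreal a) * Q a \<in> M" by metis
  define scale :: "real \<Rightarrow> 'n qpoly \<Rightarrow> 'n qpoly" where "scale r P = qreal r * P" for r P
  interpret V: vector_space scale
    by unfold_locales (simp_all add: scale_def qconst_add qconst_mult algebra_simps)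
  \<comment> \<open>Finite sets whose spans increase with \<open>m\<close> and exhaust the
    polynomials: this expresses countable dimension.\<close>
  define E :: "nat \<Rightarrow> 'n qpoly set" where
    "E m = (\<lambda>(l, e). Poly_Mapping.single l e) ` ({l. \<forall>i. Poly_Mapping.lookup l i \<le> m} \<times> {1, qi, qj, qk})" for m
  have finE: "finite (E m)" for m
  proof -
    have "finite {f :: 'n \<Rightarrow> nat. \<forall>i. f i \<in> {..m}}"
      using finite_set_of_finite_funs[of "UNIV :: 'n set" "{..m}" 0] by simp
    moreover have "Poly_Mapping.lookup ` {l :: 'n \<Rightarrow>\<^sub>0 nat. \<forall>i. Poly_Mapping.lookup l i \<le> m}
        \<subseteq> {f. \<forall>i. f i \<in> {..m}}" by auto
    ultimately have "finite (Poly_Mapping.lookup ` {l :: 'n \<Rightarrow>\<^sub>0 nat. \<forall>i. Poly_Mapping.lookup l i \<le> m})"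
      by (rule rev_finite_subset)
    moreover have "inj_on Poly_Mapping.lookup {l :: 'n \<Rightarrow>\<^sub>0 nat. \<forall>i. Poly_Mapping.lookup l i \<le> m}"
      by (rule inj_onI) (rule poly_mapping_eqI, rule fun_cong)
    ultimately have "finite {l :: 'n \<Rightarrow>\<^sub>0 nat. \<forall>i. Poly_Mapping.lookup l i \<le> m}"
      by (rule finite_imageD)
    then show ?thesis
      unfolding E_def by (intro finite_imageI finite_cartesian_product) simp_all
  qed
  have E_mono: "E m \<subseteq> E m'" if "m \<le> m'" for m m'
    unfolding E_def by (intro image_mono Sigma_mono) (auto intro: order.trans[OF _ that])
  have span: "\<exists>m. P \<in> V.span (E m)" for P
  proof (induction P rule: qpoly_induct)
    case (single l a)
    define m where "m = (\<Sum>i\<in>UNIV. Poly_Mapping.lookup l i)"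
    have "Poly_Mapping.lookup l i \<le> m" for i
      unfolding m_def by (rule member_le_sum) auto
    then have in_E: "Poly_Mapping.single l e \<in> E m" if "e \<in> {1, qi, qj, qk}" for e
      using that unfolding E_def by (intro image_eqI[of _ _ "(l, e)"]) auto
    have a: "a = of_real (q_re a) * 1 + of_real (q_i a) * qi + of_real (q_j a) * qj + of_real (q_k a) * qk"
      by (cases a) (simp add: of_real_quat quat_basis_defs quat_defs)
    have "Poly_Mapping.single l a = scale (q_re a) (Poly_Mapping.single l 1)
        + scale (q_i a) (Poly_Mapping.single l qi) + scale (q_j a) (Poly_Mapping.single l qj)
        + scale (q_k a) (Poly_Mapping.single l qk)"
      unfolding scale_def qconst_mult_single single_add[symmetric]
      by (rule arg_cong[OF a])
    also have "\<dots> \<in> V.span (E m)"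
      by (intro V.span_add V.span_scale V.span_base in_E) auto
    finally show ?case ..
  next
    case (add P R)
    then obtain m m' where "P \<in> V.span (E m)" "R \<in> V.span (E m')" by blast
    then have "P \<in> V.span (E (max m m'))" "R \<in> V.span (E (max m m'))"
      using V.span_mono[OF E_mono[of m "max m m'"]] V.span_mono[OF E_mono[of m' "max m m'"]] by auto
    then show ?case by (intro exI[of _ "max m m'"] V.span_add)
  qed
  \<comment> \<open>Countably many classes cover the reals, so one is infinite; its
    \<open>Q a\<close> share an exponent and lie in a finite-dimensional space.\<close>
  define A where "A k0 m = {a. k a = k0 \<and> Q a \<in> V.span (E m)}" for k0 m
  have "\<exists>k0 m. infinite (A k0 m)"
  proof (rule ccontr)
    assume "\<not> ?thesis"
    then have "countable (\<Union>k0. \<Union>m. A k0 m)"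
      by (intro countable_UN) (auto intro: countable_finite)
    moreover have "(\<Union>k0. \<Union>m. A k0 m) = UNIV"
      using span by (auto simp: A_def)
    ultimately show False using uncountable_UNIV_real by simp
  qed
  then obtain k0 m where A: "infinite (A k0 m)" by blast
  \<comment> \<open>If \<open>Q a = Q b\<close>, subtracting the two congruences leaves
    \<open>qreal (a - b) * Q a\<close>. Then \<open>Q a\<close>, and with it a power of
    \<open>z\<close>, would lie in \<open>M\<close>.\<close>
  have inj: "inj_on Q (A k0 m)"
  proof (rule inj_onI, rule ccontr)
    fix a b assume ab: "a \<in> A k0 m" "b \<in> A k0 m" "Q a = Q b" "a \<noteq> b"
    then have k: "k a = k0" "k b = k0" by (auto simp: A_def)
    have "(z ^ k0 - (T - qreal a) * Q a) - (z ^ k0 - (T - qreal b) * Q a) \<in> M"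
      using Qk[of a] Qk[of b] unfolding k ab(3)[symmetric] by (rule right_ideal_diff[OF M])
    also have "(z ^ k0 - (T - qreal a) * Q a) - (z ^ k0 - (T - qreal b) * Q a) = qreal (a - b) * Q a"
      by (simp add: qconst_diff algebra_simps)
    finally have "qreal (a - b) \<in> M \<or> Q a \<in> M"
      by (rule prime[OF central_qreal])
    then have "Q a \<in> M"
      using proper_qconst[OF M z[of 0], of "of_real (a - b)"] ab(4) by auto
    then have "(T - qreal a) * Q a \<in> M"
      by (intro right_ideal_central_mult[OF M] central_diff T central_qreal)
    with right_ideal_cong[OF M Qk[of a]] z show False by blast
  qed
  have "infinite (Q ` A k0 m)"
    using A finite_image_iff[OF inj] by simp
  moreover have "Q ` A k0 m \<subseteq> V.span (E m)"
    by (auto simp: A_def)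
  ultimately have "V.dependent (Q ` A k0 m)"
    using V.independent_span_bound[OF finE] by blast
  then obtain t u v0 where t: "finite t" "t \<subseteq> Q ` A k0 m" "(\<Sum>v\<in>t. scale (u v) v) = 0" "v0 \<in> t" "u v0 \<noteq> 0"
    unfolding V.dependent_explicit by blast
  from finite_subset_image[OF t(1,2)] obtain B where B: "B \<subseteq> A k0 m" "finite B" "t = Q ` B"
    by blast
  have injB: "inj_on Q B" using inj_on_subset[OF inj B(1)] .
  define c where "c a = u (Q a)" for a
  have rel: "(\<Sum>a\<in>B. qreal (c a) * Q a) = 0"
    using t(3) unfolding B(3) sum.reindex[OF injB] by (simp add: scale_def c_def)
  obtain a0 where a0: "a0 \<in> B" "c a0 \<noteq> 0"
    using t(4,5) B(3) by (auto simp: c_def)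
  \<comment> \<open>Lagrange-type products: at \<open>a0\<close> only the summand of
    \<open>a0\<close> survives in \<open>h\<close>, so \<open>h\<close> is nonzero.\<close>
  define p where "p a = (\<Prod>b\<in>B - {a}. [:- b, 1:])" for a
  define h where "h = (\<Sum>a\<in>B. smult (c a) (p a))"
  have "poly h a0 = (\<Sum>a\<in>B. c a * poly (p a) a0)"
    by (simp add: h_def poly_sum)
  also have "\<dots> = (\<Sum>a\<in>B. if a = a0 then c a0 * poly (p a0) a0 else 0)"
    using a0(1) B(2) by (intro sum.cong) (auto simp: p_def poly_prod)
  also have "\<dots> = c a0 * poly (p a0) a0"
    using a0(1) B(2) by simp
  also have "\<dots> \<noteq> 0"
    using a0(2) B(2) by (auto simp: p_def poly_prod)
  finally have "h \<noteq> 0" by auto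
  have p: "qpoly_subst T (p a) * (T - qreal a) = qpoly_subst T (\<Prod>b\<in>B. [:- b, 1:])" if "a \<in> B" for a
    unfolding lin[symmetric] qpoly_subst_mult[symmetric] prod.remove[OF B(2) that] p_def
    by (simp only: mult.commute)
  \<comment> \<open>Modulo \<open>M\<close>, each \<open>z ^ k0\<close> is
    \<open>(T - qreal a) * Q a\<close>. The missing factor completes \<open>p a\<close> to a product
    common to all summands, which multiplies the vanishing relation.\<close>
  have "qpoly_subst T h * z ^ k0 = (\<Sum>a\<in>B. qreal (c a) * qpoly_subst T (p a) * z ^ k0)"
    by (simp add: h_def qpoly_subst_sum qpoly_subst_smult sum_distrib_right)
  also have "\<dots> = (\<Sum>a\<in>B. qreal (c a) * (qpoly_subst T (p a) * (z ^ k0 - (T - qreal a) * Q a)))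
      + (\<Sum>a\<in>B. qreal (c a) * (qpoly_subst T (p a) * (T - qreal a) * Q a))"
    unfolding sum.distrib[symmetric]
    by (intro sum.cong refl) (simp only: distrib_left[symmetric] mult.assoc diff_add_cancel)
  also have "(\<Sum>a\<in>B. qreal (c a) * (qpoly_subst T (p a) * (T - qreal a) * Q a))
      = (\<Sum>a\<in>B. qpoly_subst T (\<Prod>b\<in>B. [:- b, 1:]) * (qreal (c a) * Q a))"
    using central_commute[OF central_qreal, of _ "qpoly_subst T (\<Prod>b\<in>B. [:- b, 1:])"]
    by (intro sum.cong refl) (simp add: p mult.assoc[symmetric])
  also have "\<dots> = 0"
    by (simp add: sum_distrib_left[symmetric] rel)
  finally have eq: "qpoly_subst T h * z ^ k0 =
      (\<Sum>a\<in>B. qreal (c a) * (qpoly_subst T (p a) * (z ^ k0 - (T - qreal a) * Q a)))"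
    by simp
  have "z ^ k0 - (T - qreal a) * Q a \<in> M" if "a \<in> B" for a
    using Qk[of a] that B(1) by (auto simp: A_def)
  then have "qpoly_subst T h * z ^ k0 \<in> M"
    unfolding eq
    by (intro right_ideal_sum[OF M] right_ideal_central_mult[OF M] central_qreal central_qpoly_subst T)
  then have "qpoly_subst T h \<in> M"
    using prime[OF central_qpoly_subst[OF T]] z by blast
  with no[OF \<open>h \<noteq> 0\<close>] show False by blast
qed

text \<open>It suffices to separate the central \<open>z\<close> congruent to \<open>f * Q\<close>:
  a point ideal containing \<open>L\<close> and \<open>f\<close> contains \<open>z\<close>.
  Enlarging \<open>L\<close> to a maximal \<open>M\<close> that avoids the powers of
  \<open>z\<close> gives the equations required by \<open>separating_point\<close>.\<close>

lemma completely_prime_separating_point: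
  fixes L :: "'n::{finite,linorder} qpoly set"
  assumes L: "completely_prime L" and f: "f \<notin> L"
  obtains q where "commuting q" "L \<subseteq> point_ideal q" "f \<notin> point_ideal q"
proof -
  obtain Q z where z: "central z" "z \<notin> L" and Q: "f * Q - z \<in> L"
    using completely_prime_central_multiple[OF L f] .
  have rL: "right_ideal L" using L by (simp add: completely_prime_def)
  have disj: "L \<inter> range (\<lambda>k. z ^ k) = {}"
    using completely_prime_central_power[OF L z] by auto
  obtain M where M: "right_ideal M" and LM: "L \<subseteq> M" and zM: "M \<inter> range (\<lambda>k. z ^ k) = {}"
    and gen0: "\<And>g. g \<notin> M \<Longrightarrow> \<exists>Q. \<exists>s\<in>range (\<lambda>k. z ^ k). s - g * Q \<in> M"
    using maximal_right_ideal_avoiding[OF rL disj] by metis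
  have z_notin: "z ^ k \<notin> M" for k using zM by auto
  have gen: "\<exists>Q k. z ^ k - g * Q \<in> M" if "g \<notin> M" for g
    using gen0[OF that] by blast
  \<comment> \<open>Otherwise \<open>z ^ k\<close> is congruent to \<open>c * P\<close> and
    \<open>z ^ j\<close> to \<open>d * R\<close>. Centrality of \<open>c\<close> and of the powers
    of \<open>z\<close> makes \<open>z ^ (j + k)\<close> congruent to \<open>c * d * R * P\<close>,
    which lies in \<open>M\<close>.\<close>
  have prime: "c \<in> M \<or> d \<in> M" if c: "central c" and cd: "c * d \<in> M" for c d
  proof (rule ccontr)
    assume "\<not> ?thesis"
    then obtain P k R j where P: "z ^ k - c * P \<in> M" and R: "z ^ j - d * R \<in> M"
      using gen by meson
    have zk: "central (z ^ k)" "central (z ^ j)" by (intro central_power z)+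
    have "z ^ j * (z ^ k - c * P) \<in> M" by (intro right_ideal_central_mult[OF M] zk P)
    moreover have "c * (z ^ j - d * R) * P \<in> M"
      by (intro right_ideal_mult[OF M] right_ideal_central_mult[OF M c] R)
    moreover have "c * d * R * P \<in> M" by (intro right_ideal_mult[OF M] cd)
    ultimately have "z ^ j * (z ^ k - c * P) + (c * (z ^ j - d * R) * P + c * d * R * P) \<in> M"
      by (intro right_ideal_add[OF M])
    also have "z ^ j * (z ^ k - c * P) + (c * (z ^ j - d * R) * P + c * d * R * P) = z ^ (j + k)"
      using central_commute[OF zk(2), of c]
      by (simp add: right_diff_distrib left_diff_distrib power_add mult.assoc[symmetric])
    finally show False using z_notin by blast
  qed
  have quad: "(\<exists>a. qvar i - qreal a \<in> M) \<or>
      (\<exists>a b. b \<noteq> 0 \<and> (qvar i - qreal a)\<^sup>2 + qreal (b\<^sup>2) \<in> M)" for i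
  proof -
    obtain h where h: "h \<noteq> 0" "qpoly_subst (qvar i) h \<in> M"
      using algebraic_modulo[OF M z_notin gen prime central_qvar] by blast
    have "1 \<notin> M" using z_notin[of 0] by simp
    from quadratic_in_prime[OF M this prime central_qvar h(2,1)] show ?thesis .
  qed
  have "z \<notin> M" using z_notin[of 1] by simp
  from separating_point[OF M this quad] obtain q where
    q: "commuting q" "M \<subseteq> point_ideal q" "z \<notin> point_ideal q" .
  have "f \<notin> point_ideal q"
  proof
    assume "f \<in> point_ideal q"
    then have "f * Q \<in> point_ideal q" by (rule right_ideal_mult[OF right_ideal_point_ideal])
    moreover have "f * Q - z \<in> point_ideal q" using Q LM q(2) by blast
    ultimately show False using right_ideal_cong[OF right_ideal_point_ideal] q(3) by blast
  qed
  with q LM show ?thesis by (intro that[of q]) auto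
qed

section \<open>Comparison of the vanishing ideal with the right radical\<close>

theorem theorem4p3:
  fixes I :: "'n::{finite,linorder} qpoly set"
  assumes "right_ideal I"
  shows "vanishing_ideal (zero_set I) = right_radical I"
proof (intro set_eqI iffI)
  fix P assume "P \<in> vanishing_ideal (zero_set I)"
  then obtain N :: nat and F G where P: "P = (\<Sum>k<N. F k * G k)"
    and F: "\<forall>k<N. \<forall>q\<in>zero_set I. qpoly_eval (F k) q = 0"
    unfolding vanishing_ideal_def by blast
  show "P \<in> right_radical I"
    unfolding right_radical_def
  proof (rule InterI)
    fix L assume "L \<in> {L. completely_prime L \<and> I \<subseteq> L}"
    then have L: "completely_prime L" "I \<subseteq> L" and rL: "right_ideal L"
      by (auto simp: completely_prime_def)
    \<comment> \<open>A separating commuting point would be a zero of \<open>L\<close>, hence of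
      \<open>I\<close>, at which \<open>F k\<close> vanishes; at commuting points vanishing already
      means membership in the point ideal.\<close>
    have "F k \<in> L" if "k < N" for k
    proof (rule ccontr)
      assume "F k \<notin> L"
      with L(1) obtain q where q: "commuting q" "L \<subseteq> point_ideal q" "F k \<notin> point_ideal q"
        by (rule completely_prime_separating_point)
      have "q \<in> zero_set I"
        using L(2) q(2) qpoly_eval_point_ideal unfolding zero_set_def by blast
      with F that q(1,3) show False by (simp add: point_ideal_commuting)
    qed
    then show "P \<in> L"
      unfolding P by (intro right_ideal_sum[OF rL] right_ideal_mult[OF rL]) simp
  qed
next
  fix P assume P: "P \<in> right_radical I"
  \<comment> \<open>The zero \<open>q\<close> need not commute. It is replaced by a commuting
    \<open>q'\<close> still separating \<open>P\<close>; the ideal of \<open>q'\<close> contains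
    \<open>I\<close> and is completely prime, so it contains the radical.\<close>
  have vanish: "qpoly_eval P q = 0" if q: "q \<in> zero_set I" for q
  proof (rule ccontr)
    assume "qpoly_eval P q \<noteq> 0"
    then have "P \<notin> point_ideal q" using qpoly_eval_point_ideal by blast
    from separating_point[OF right_ideal_point_ideal this point_ideal_quadratic]
    obtain q' where q': "commuting q'" "point_ideal q \<subseteq> point_ideal q'" "P \<notin> point_ideal q'" .
    have "I \<subseteq> point_ideal q'"
      using subset_point_ideal[OF assms q] q'(2) by blast
    with P completely_prime_point_ideal[OF q'(1)] have "P \<in> point_ideal q'"
      unfolding right_radical_def by blast
    with q'(3) show False ..
  qed
  \<comment> \<open>The single summand \<open>P * 1\<close> suffices, as \<open>P\<close> itself
    vanishes on the zero set.\<close>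
  show "P \<in> vanishing_ideal (zero_set I)"
    unfolding vanishing_ideal_def mem_Collect_eq
    by (intro exI[of _ 1] exI[of _ "\<lambda>_. P"] exI[of _ "\<lambda>_. 1"]) (simp add: vanish)
qed

end
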